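(* Let $\mathcal{H}=\{x+y\mathbf{i}\in\mathbb{C} : x,y\in\mathbb{R},\ x>0 \text{ or } (x=0 \text{ and } y\ge 0)\}$. For a field $K\in\{\mathbb{R},\mathbb{C}\}$, consider the following algebras over $K$ on a linear base $\{e,f,g\}$, given by their multiplication tables. $U^3_0, U^3_1, U^3_2, U^3_3, U^3_4$ are defined respectively by $$\begin{pmatrix} e & f & g \\ f & 0 & 0 \\ g & 0 & 0\end{pmatrix},\ \begin{pmatrix} e & f & g \\ f & 0 & f \\ g & -f & e\end{pmatrix},\ \begin{pmatrix} e & 0 & 0\\ 0 & f & 0\\ 0 & 0 & g\end{pmatrix},\ \begin{pmatrix} e & 0 & 0\\ 0 & f & g\\ 0 & g & 0\end{pmatrix},\ \begin{pmatrix} e & f & g \\ f & g & 0 \\ g & 0 & 0\end{pmatrix}.$$ $C^3_0, C^3_1, C^3_2, C^3_3, C^3_4$ are defined respectively by $$\begin{pmatrix} 0 & 0 & 0 \\ 0 & 0 & 0 \\ 0 & 0 & 0\end{pmatrix},\ \begin{pmatrix} 0 & 0 & 0 \\ 0 & 0 & e \\ 0 & -e & 0\end{pmatrix},\ \begin{pmatrix} 0 & 0 & 0 \\ e & f & 0 \\ 0 & g & 0\end{pmatrix},\ \begin{pmatrix} 0 & 0 & 0 \\ 0 & 0 & 0 \\ e & f & g\end{pmatrix},\ \begin{pmatrix} 0 & 0 & e \\ 0 & 0 & f \\ 0 & 0 & g\end{pmatrix}.$$ $S^3_1, S^3_2, S^3_3, S^3_4$ are defined respectively by $$\begin{pmatrix}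 f & g & 0 \\ g & 0 & 0 \\ 0 & 0 & 0 \end{pmatrix},\ \begin{pmatrix} e & 0 & 0 \\ 0 & g & 0 \\ 0 & 0 & 0 \end{pmatrix},\ \begin{pmatrix} e & f & 0 \\ f & e & 0 \\ 0 & 0 & 0 \end{pmatrix},\ \begin{pmatrix} e & f & 0 \\ f & 0 & 0 \\ 0 & 0 & 0 \end{pmatrix}.$$ $W^3_1, W^3_2, W^3_4, W^3_5, W^3_6$ are defined respectively by $$\begin{pmatrix} 0 & 0 & 0 \\ 0 & 0 & 0 \\ 0 & 0 & e\end{pmatrix},\ \begin{pmatrix} 0 & 0 & 0 \\ 0 & 0 & 0 \\ 0 & e & 0\end{pmatrix},\ \begin{pmatrix} e & 0 & 0 \\ 0 & 0 & 0 \\ 0 & 0 & 0\end{pmatrix},\ \begin{pmatrix} 0 & 0 & 0 \\ 0 & 0 & 0 \\ 0 & f & g\end{pmatrix},\ \begin{pmatrix} 0 & 0 & 0 \\ 0 & 0 & f \\ 0 & 0 & g\end{pmatrix},$$ and $W^3_7, W^3_8, W^3_9, W^3_{10}$ respectively by $$\begin{pmatrix} e & 0 & 0 \\ 0 & 0 & 0 \\ 0 & f & g\end{pmatrix},\ \begin{pmatrix} e & 0 & 0 \\ 0 & 0 & f \\ 0 & 0 & g\end{pmatrix},\ \begin{pmatrix} 0 & e & 0 \\ e & f & 0 \\ 0 & g & 0\end{pmatrix},\ \begin{pmatrix} 0 & e & 0 \\ e & f & g \\ 0 & 0 & 0\end{pmatrix}.$$ For $k\in K$, $W^3_3(k)$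 is defined by $$\begin{pmatrix} 0 & 0 & 0 \\ 0 & e & 0 \\ 0 & ke & e\end{pmatrix}.$$ For $K=\mathbb{R}$ and $k\in\mathbb{R}$, the algebras $U^3_{2^-}$, $S^3_{3^-}$, $W^3_{3^-}(k)$ are defined respectively by $$\begin{pmatrix} e & 0 & 0\\ 0 & f & g\\ 0 & g & -f\end{pmatrix},\ \begin{pmatrix} e & f & 0 \\ f & -e & 0 \\ 0 & 0 & 0 \end{pmatrix},\ \begin{pmatrix} 0 & 0 & 0 \\ 0 & e & 0 \\ 0 & ke & -e\end{pmatrix}.$$ Then: (1) Over $\mathbb{C}$, every $3$-dimensional algebra is isomorphic to exactly one of the following, which are pairwise non-isomorphic: the $5$ unital algebras $U^3_0,U^3_1,U^3_2,U^3_3,U^3_4$; the $5$ non-unital curled algebras $C^3_0,C^3_1,C^3_2,C^3_3,C^3_4$; the $4$ non-unital straight algebras $S^3_1,S^3_2,S^3_3,S^3_4$; the $9$ non-unital waved algebras $W^3_1,W^3_2,W^3_4,W^3_5,W^3_6,W^3_7,W^3_8,W^3_9,W^3_{10}$; and the members of the infinite family $\{W^3_3(k)\}_{k\in\mathcal{H}}$ of non-unital waved algebras. (2) Over $\mathbb{R}$, every $3$-dimensional algebra is isomorphic to exactly one of the following, which are pairwise non-isomorphic: the $6$ unital algebras $U^3_0,U^3_1,U^3_2,U^3_3,U^3_4,U^3_{2^-}$; the $5$ non-unital curled algebras $C^3_0,\dots,C^3_4$; the $5$ non-unital straight algebras $S^3_1,S^3_2,S^3_3,S^3_4,S^3_{3^-}$;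 the $9$ non-unital waved algebras $W^3_1,W^3_2,W^3_4,W^3_5,W^3_6,W^3_7,W^3_8,W^3_9,W^3_{10}$; and the members of the two infinite families $\{W^3_3(k)\}_{k\in\mathbb{R},\,k\ge 0}$ and $\{W^3_{3^-}(k)\}_{k\in\mathbb{R},\,k\ge 0}$ of non-unital waved algebras.
   Context: Algebras are associative but not necessarily unital, and not necessarily commutative. Isomorphism means isomorphism of $K$-algebras (a $K$-linear bijection preserving products). Multiplication tables: the algebra on the linear base $\{e_1,\dots,e_n\}$ defined by the $n\times n$ matrix $(a_{ij})$ of elements $a_{ij}$ of the $K$-span of $e_1,\dots,e_n$ is the $K$-vector space with that base and bilinear product determined by $e_ie_j=a_{ij}$ ($i$ indexes the row, $j$ the column). For tables on $\{e,f,g\}$ one takes $e_1=e$, $e_2=f$, $e_3=g$. Let $A$ be an algebra of dimension $3$ over $K$. $A$ is curled if $x, x^2$ are linearly dependent over $K$ for every $x\in A$. $A$ is waved if it is not curled but $x,x^2,x^3$ are linearly dependent over $K$ for every $x\in A$. $A$ is straight if it is neither curled nor waved, i.e. if there is $x\in A$ such that $\{x,x^2,x^3\}$ is a linear base of $A$. (Linear dependence is understood for the list of elements, so that repeated elements count as dependent.) *)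

theory Defs
  imports "HOL-Analysis.Analysis"
begin

text \<open>Associative algebras, not necessarily unital or commutative, over an arbitrary field.\<close>

locale assoc_algebra = vector_space smul
  for smul :: "'k::field \<Rightarrow> 'a::ab_group_add \<Rightarrow> 'a" +
  fixes mul :: "'a \<Rightarrow> 'a \<Rightarrow> 'a"
  assumes linear_mult_left: "\<And>y. Vector_Spaces.linear smul smul (\<lambda>x. mul x y)"
    and linear_mult_right: "\<And>x. Vector_Spaces.linear smul smul (\<lambda>y. mul x y)"
    and mult_assoc: "\<And>x y z. mul (mul x y) z = mul x (mul y z)"

definition algebra3 :: "('k::field \<Rightarrow> 'a::ab_group_add \<Rightarrow> 'a) \<Rightarrow> ('a \<Rightarrow> 'a \<Rightarrow> 'a) \<Rightarrow> bool" where
  "algebra3 smul mul \<longleftrightarrow> assoc_algebra smul mul \<and> vector_space.dim smul UNIV = 3"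

definition algebra_isomorphic ::
  "('k::field \<Rightarrow> 'a::ab_group_add \<Rightarrow> 'a) \<Rightarrow> ('a \<Rightarrow> 'a \<Rightarrow> 'a) \<Rightarrow>
   ('k \<Rightarrow> 'b::ab_group_add \<Rightarrow> 'b) \<Rightarrow> ('b \<Rightarrow> 'b \<Rightarrow> 'b) \<Rightarrow> bool" where
  "algebra_isomorphic smul mul smul' mul' \<longleftrightarrow>
     (\<exists>\<phi>. Vector_Spaces.linear smul smul' \<phi> \<and> bij \<phi> \<and>
          (\<forall>x y. \<phi> (mul x y) = mul' (\<phi> x) (\<phi> y)))"

definition unital :: "('a \<Rightarrow> 'a \<Rightarrow> 'a) \<Rightarrow> bool" where
  "unital mul \<longleftrightarrow> (\<exists>u. \<forall>x. mul u x = x \<and> mul x u = x)"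

text \<open>Linear dependence of a list: repeated entries make the list dependent, unlike for
  \<^const>\<open>module.dependent\<close> applied to the set of its entries.\<close>

definition dependent_list :: "('k::field \<Rightarrow> 'a::ab_group_add \<Rightarrow> 'a) \<Rightarrow> 'a list \<Rightarrow> bool" where
  "dependent_list smul xs \<longleftrightarrow>
     (\<exists>c :: nat \<Rightarrow> 'k. (\<exists>i<length xs. c i \<noteq> 0) \<and>
        (\<Sum>i<length xs. smul (c i) (xs ! i)) = 0)"

definition curled :: "('k::field \<Rightarrow> 'a::ab_group_add \<Rightarrow> 'a) \<Rightarrow> ('a \<Rightarrow> 'a \<Rightarrow> 'a) \<Rightarrow> bool" where
  "curled smul mul \<longleftrightarrow> (\<forall>x. dependent_list smul [x, mul x x])"

definition waved :: "('k::field \<Rightarrow> 'a::ab_group_add \<Rightarrow> 'a) \<Rightarrow> ('a \<Rightarrow> 'a \<Rightarrow> 'a) \<Rightarrow> bool" where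
  "waved smul mul \<longleftrightarrow> \<not> curled smul mul \<and>
     (\<forall>x. dependent_list smul [x, mul x x, mul (mul x x) x])"

definition straight :: "('k::field \<Rightarrow> 'a::ab_group_add \<Rightarrow> 'a) \<Rightarrow> ('a \<Rightarrow> 'a \<Rightarrow> 'a) \<Rightarrow> bool" where
  "straight smul mul \<longleftrightarrow> \<not> curled smul mul \<and> \<not> waved smul mul"

text \<open>The product on \<^typ>\<open>'k^3\<close> given by a multiplication table whose \<open>(i,j)\<close> entry is the
  product of the \<open>i\<close>-th and the \<open>j\<close>-th standard basis vector.\<close>

definition table_mult :: "('k::field^3)^3^3 \<Rightarrow> 'k^3 \<Rightarrow> 'k^3 \<Rightarrow> 'k^3" where
  "table_mult T x y = (\<Sum>i\<in>UNIV. \<Sum>j\<in>UNIV. (x $ i * y $ j) *s (T $ i $ j))"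

text \<open>Names of the algebras in the classification. The suffix \<open>m\<close> stands for the
  superscript minus sign in the index, as in $U^3_{2^-}$, $S^3_{3^-}$ and $W^3_{3^-}(k)$.\<close>

datatype 'k alg_name =
    U0 | U1 | U2 | U3 | U4 | U2m
  | C0 | C1 | C2 | C3 | C4
  | S1 | S2 | S3 | S4 | S3m
  | W1 | W2 | W3 'k | W4 | W5 | W6 | W7 | W8 | W9 | W10 | W3m 'k

definition table :: "'k::field alg_name \<Rightarrow> ('k^3)^3^3" where
  "table A =
    (let e = axis 1 1; f = axis 2 1; g = axis 3 1 in
     vector (map vector (case A of
       U0 \<Rightarrow> [[e, f, g],
              [f, 0, 0],
              [g, 0, 0]]
     | U1 \<Rightarrow> [[e, f, g],
              [f, 0, f],
              [g, - f, e]]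
     | U2 \<Rightarrow> [[e, 0, 0],
              [0, f, 0],
              [0, 0, g]]
     | U3 \<Rightarrow> [[e, 0, 0],
              [0, f, g],
              [0, g, 0]]
     | U4 \<Rightarrow> [[e, f, g],
              [f, g, 0],
              [g, 0, 0]]
     | U2m \<Rightarrow> [[e, 0, 0],
               [0, f, g],
               [0, g, - f]]
     | C0 \<Rightarrow> [[0, 0, 0],
              [0, 0, 0],
              [0, 0, 0]]
     | C1 \<Rightarrow> [[0, 0, 0],
              [0, 0, e],
              [0, - e, 0]]
     | C2 \<Rightarrow> [[0, 0, 0],
              [e, f, 0],
              [0, g, 0]]
     | C3 \<Rightarrow> [[0, 0, 0],
              [0, 0, 0],
              [e, f, g]]
     | C4 \<Rightarrow> [[0, 0, e],
              [0, 0, f],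
              [0, 0, g]]
     | S1 \<Rightarrow> [[f, g, 0],
              [g, 0, 0],
              [0, 0, 0]]
     | S2 \<Rightarrow> [[e, 0, 0],
              [0, g, 0],
              [0, 0, 0]]
     | S3 \<Rightarrow> [[e, f, 0],
              [f, e, 0],
              [0, 0, 0]]
     | S4 \<Rightarrow> [[e, f, 0],
              [f, 0, 0],
              [0, 0, 0]]
     | S3m \<Rightarrow> [[e, f, 0],
               [f, - e, 0],
               [0, 0, 0]]
     | W1 \<Rightarrow> [[0, 0, 0],
              [0, 0, 0],
              [0, 0, e]]
     | W2 \<Rightarrow> [[0, 0, 0],
              [0, 0, 0],
              [0, e, 0]]
     | W3 k \<Rightarrow> [[0, 0, 0],
                [0, e, 0],
                [0, k *s e, e]]
     | W4 \<Rightarrow> [[e, 0, 0],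
              [0, 0, 0],
              [0, 0, 0]]
     | W5 \<Rightarrow> [[0, 0, 0],
              [0, 0, 0],
              [0, f, g]]
     | W6 \<Rightarrow> [[0, 0, 0],
              [0, 0, f],
              [0, 0, g]]
     | W7 \<Rightarrow> [[e, 0, 0],
              [0, 0, 0],
              [0, f, g]]
     | W8 \<Rightarrow> [[e, 0, 0],
              [0, 0, f],
              [0, 0, g]]
     | W9 \<Rightarrow> [[0, e, 0],
              [e, f, 0],
              [0, g, 0]]
     | W10 \<Rightarrow> [[0, e, 0],
               [e, f, g],
               [0, 0, 0]]
     | W3m k \<Rightarrow> [[0, 0, 0],
                 [0, e, 0],
                 [0, k *s e, - e]])))"

abbreviation amult :: "'k::field alg_name \<Rightarrow> 'k^3 \<Rightarrow> 'k^3 \<Rightarrow> 'k^3" where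
  "amult A \<equiv> table_mult (table A)"

definition half_plane :: "complex set" where
  "half_plane = {z. Re z > 0 \<or> (Re z = 0 \<and> Im z \<ge> 0)}"

definition U_complex :: "complex alg_name set" where
  "U_complex = {U0, U1, U2, U3, U4}"

definition C_complex :: "complex alg_name set" where
  "C_complex = {C0, C1, C2, C3, C4}"

definition S_complex :: "complex alg_name set" where
  "S_complex = {S1, S2, S3, S4}"

definition W_complex :: "complex alg_name set" where
  "W_complex = {W1, W2, W4, W5, W6, W7, W8, W9, W10} \<union> W3 ` half_plane"

definition U_real :: "real alg_name set" where
  "U_real = {U0, U1, U2, U3, U4, U2m}"

definition C_real :: "real alg_name set" where
  "C_real = {C0, C1, C2, C3, C4}"

definition S_real :: "real alg_name set" where
  "S_real = {S1, S2, S3, S4, S3m}"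

definition W_real :: "real alg_name set" where
  "W_real = {W1, W2, W4, W5, W6, W7, W8, W9, W10} \<union> W3 ` {0..} \<union> W3m ` {0..}"

definition names_complex :: "complex alg_name set" where
  "names_complex = U_complex \<union> C_complex \<union> S_complex \<union> W_complex"

definition names_real :: "real alg_name set" where
  "names_real = U_real \<union> C_real \<union> S_real \<union> W_real"

end

theory Submission
  imports Defs "HOL-Computational_Algebra.Fundamental_Theorem_Algebra"
begin

text \<open>
  The classification has two halves: every three-dimensional algebra has a basis with one of the
  listed tables, and the listed tables are told apart by invariants.

  \<^bold>\<open>Existence.\<close> The scalars enter only through two properties shared by \<open>\<real>\<close> and \<open>\<complex>\<close>: every scalar is
  \<open>s\<^sup>2\<close> or \<open>- s\<^sup>2\<close>, and every monic cubic has a root. Over such a field every three-dimensional algebra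
  is given by one of the names, the minus forms included and without a restriction on the
  parameter \<open>k\<close> (\<open>classified\<close>). In dimension three the powers \<open>x, x\<^sup>2, x\<^sup>3, x\<^sup>4\<close> are dependent, and the
  relation between them yields either \<open>x\<^sup>4 = 0\<close> or an idempotent that is a polynomial in \<open>x\<close>
  (\<open>idempotent_among_powers\<close>). This separates two cases.

  With an idempotent \<open>e\<close>, left and right multiplication by \<open>e\<close> are commuting projections, so there is
  a basis \<open>e, v, w\<close> of joint eigenvectors. Associativity together with the eigenvalues of \<open>v\<close> and
  \<open>w\<close> forces almost all products. The cases that remain open are reduced to the unital algebras, or to
  an idempotent \<open>e + f\<close> with a larger corner. A unital algebra is either \<open>K[x]\<close> modulo a cubic, which
  is decomposed with the help of a root (\<open>unital_cubic\<close>), or all its elements are quadratic over \<open>K\<close>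
  (\<open>unital_quadratic\<close>).

  If all elements are nilpotent, the nilpotency index decides: index four gives \<open>S\<^sub>1\<close>, index two gives
  an anticommutative product, and in index three the algebra is a bilinear form on a plane with values in
  the line of \<open>x\<^sup>2\<close> (\<open>square_of_nil_index_3\<close>), which completing the square brings to a normal form.

  \<^bold>\<open>Uniqueness.\<close> The kinds unital, straight and waved and a few elementary statements about
  the product, such as the existence of an idempotent or of a left annihilator, are preserved by
  isomorphisms and separate all names except the two families and the pairs that become isomorphic
  over \<open>\<complex>\<close> (\<open>isomorphic_amult\<close>); over \<open>\<real>\<close> an element with \<open>x\<^sup>3 = - x\<close> separates
  these pairs. For the families, the bilinear form with matrix rows \<open>(1, 0)\<close> and
  \<open>(k, \<plusminus>1)\<close> has determinant \<open>\<plusminus>1\<close> and the value \<open>k\<close> as its skew part. A change of basis with determinant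
  \<open>d\<close> that rescales the line of values by \<open>m\<close> relates the determinants by \<open>d\<^sup>2\<close> and \<open>m\<^sup>2\<close> and the skew
  parts by \<open>d\<close> and \<open>m\<close>; so \<open>k\<^sup>2\<close> is an invariant and, over \<open>\<real>\<close>, so is the sign
  (\<open>W3_form_invariants\<close>). The substitution \<open>g \<mapsto> - g\<close> identifies \<open>k\<close> with \<open>- k\<close>, which is why the
  parameter is restricted to a half-plane or half-line.
\<close>

section \<open>Coordinates in dimension three\<close>

abbreviation vec3 :: "'k::zero \<Rightarrow> 'k \<Rightarrow> 'k \<Rightarrow> 'k^3" where
  "vec3 a b c \<equiv> vector [a, b, c]"

lemma vec3_arith [simp]:
  fixes a b c :: "'k::field"
  shows "vec3 a b c + vec3 a' b' c' = vec3 (a + a') (b + b') (c + c')"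
    and "vec3 a b c - vec3 a' b' c' = vec3 (a - a') (b - b') (c - c')"
    and "- vec3 a b c = vec3 (- a) (- b) (- c)"
    and "k *s vec3 a b c = vec3 (k * a) (k * b) (k * c)"
    and "vec3 a b c = vec3 a' b' c' \<longleftrightarrow> a = a' \<and> b = b' \<and> c = c'"
    and "vec3 a b c = 0 \<longleftrightarrow> a = 0 \<and> b = 0 \<and> c = 0"
    and "0 = vec3 a b c \<longleftrightarrow> a = 0 \<and> b = 0 \<and> c = 0"
  by (auto simp: vec_eq_iff forall_3)

lemma axis3:
  "axis 1 1 = vec3 1 0 (0::'k::field)" "axis 2 1 = vec3 0 1 (0::'k)" "axis 3 1 = vec3 0 0 (1::'k)"
  by (simp_all add: vec_eq_iff forall_3 axis_def)

lemma vec3_cases: obtains a b c where "x = vec3 a b c"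
proof
  show "x = vec3 (x $ 1) (x $ 2) (x $ 3)" by (simp add: vec_eq_iff forall_3)
qed

lemma all_vec3: "(\<forall>x::'k::zero^3. P x) \<longleftrightarrow> (\<forall>a b c. P (vec3 a b c))"
  by (rule forall_vector_3)

lemma ex_vec3: "(\<exists>x::'k::zero^3. P x) \<longleftrightarrow> (\<exists>a b c. P (vec3 a b c))"
  by (metis vec3_cases)

text \<open>Together with the rules for \<^term>\<open>vec3\<close>, this turns every identity about a table into
  polynomial identities between coordinates.\<close>
lemma table_mult_vec3:
  "table_mult T (vec3 a b c) (vec3 a' b' c') =
     (a * a') *s T $ 1 $ 1 + (a * b') *s T $ 1 $ 2 + (a * c') *s T $ 1 $ 3
   + (b * a') *s T $ 2 $ 1 + (b * b') *s T $ 2 $ 2 + (b * c') *s T $ 2 $ 3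
   + (c * a') *s T $ 3 $ 1 + (c * b') *s T $ 3 $ 2 + (c * c') *s T $ 3 $ 3"
  by (simp add: table_mult_def sum_3)

context
  fixes a b c p q r :: "'k::field"
begin

lemma amult_simps:
  shows "amult U0 (vec3 a b c) (vec3 p q r) = vec3 (a*p) (a*q + b*p) (a*r + c*p)"
    and "amult U1 (vec3 a b c) (vec3 p q r) = vec3 (a*p + c*r) (a*q + b*p + b*r - c*q) (a*r + c*p)"
    and "amult U2 (vec3 a b c) (vec3 p q r) = vec3 (a*p) (b*q) (c*r)"
    and "amult U3 (vec3 a b c) (vec3 p q r) = vec3 (a*p) (b*q) (b*r + c*q)"
    and "amult U4 (vec3 a b c) (vec3 p q r) = vec3 (a*p) (a*q + b*p) (a*r + b*q + c*p)"
    and "amult U2m (vec3 a b c) (vec3 p q r) = vec3 (a*p) (b*q - c*r) (b*r + c*q)"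
    and "amult C0 (vec3 a b c) (vec3 p q r) = vec3 0 0 0"
    and "amult C1 (vec3 a b c) (vec3 p q r) = vec3 (b*r - c*q) 0 0"
    and "amult C2 (vec3 a b c) (vec3 p q r) = vec3 (b*p) (b*q) (c*q)"
    and "amult C3 (vec3 a b c) (vec3 p q r) = vec3 (c*p) (c*q) (c*r)"
    and "amult C4 (vec3 a b c) (vec3 p q r) = vec3 (a*r) (b*r) (c*r)"
    and "amult S1 (vec3 a b c) (vec3 p q r) = vec3 0 (a*p) (a*q + b*p)"
    and "amult S2 (vec3 a b c) (vec3 p q r) = vec3 (a*p) 0 (b*q)"
    and "amult S3 (vec3 a b c) (vec3 p q r) = vec3 (a*p + b*q) (a*q + b*p) 0"
    and "amult S4 (vec3 a b c) (vec3 p q r) = vec3 (a*p) (a*q + b*p) 0"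
    and "amult S3m (vec3 a b c) (vec3 p q r) = vec3 (a*p - b*q) (a*q + b*p) 0"
    and "amult W1 (vec3 a b c) (vec3 p q r) = vec3 (c*r) 0 0"
    and "amult W2 (vec3 a b c) (vec3 p q r) = vec3 (c*q) 0 0"
    and "amult (W3 k) (vec3 a b c) (vec3 p q r) = vec3 (b*q + k*(c*q) + c*r) 0 0"
    and "amult W4 (vec3 a b c) (vec3 p q r) = vec3 (a*p) 0 0"
    and "amult W5 (vec3 a b c) (vec3 p q r) = vec3 0 (c*q) (c*r)"
    and "amult W6 (vec3 a b c) (vec3 p q r) = vec3 0 (b*r) (c*r)"
    and "amult W7 (vec3 a b c) (vec3 p q r) = vec3 (a*p) (c*q) (c*r)"
    and "amult W8 (vec3 a b c) (vec3 p q r) = vec3 (a*p) (b*r) (c*r)"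
    and "amult W9 (vec3 a b c) (vec3 p q r) = vec3 (a*q + b*p) (b*q) (c*q)"
    and "amult W10 (vec3 a b c) (vec3 p q r) = vec3 (a*q + b*p) (b*q) (b*r)"
    and "amult (W3m k) (vec3 a b c) (vec3 p q r) = vec3 (b*q + k*(c*q) - c*r) 0 0"
  by (simp_all add: table_mult_vec3 table_def axis3 Let_def algebra_simps)

end

text \<open>A table product is bilinear by construction, so associativity is the only condition.\<close>
lemma assoc_algebra_table:
  assumes "\<And>x y z. table_mult T (table_mult T x y) z = table_mult T x (table_mult T y z)"
  shows "algebra3 (*s) (table_mult T)"
proof -
  have "Vector_Spaces.linear (*s) (*s) (\<lambda>y. table_mult T y x)"
    "Vector_Spaces.linear (*s) (*s) (\<lambda>y. table_mult T x y)" for x :: "'a^3"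
    unfolding Vector_Spaces.linear_iff
    by (auto simp: vec.vector_space_axioms table_mult_def sum_3 vec.scale_right_distrib
        vec.scale_left_distrib algebra_simps)
  then have "assoc_algebra (*s) (table_mult T)"
    using assms by (simp add: assoc_algebra_def assoc_algebra_axioms_def vec.vector_space_axioms)
  then show ?thesis
    by (simp add: algebra3_def card_cart_basis)
qed

lemma algebra3_amult: "algebra3 (*s) (amult (A :: 'k::field alg_name))"
proof (rule assoc_algebra_table)
  fix x y z :: "'k^3"
  obtain a b c p q r a' b' c' where "x = vec3 a b c" "y = vec3 p q r" "z = vec3 a' b' c'"
    using vec3_cases by metis
  then show "amult A (amult A x y) z = amult A x (amult A y z)"
    by (cases A) (simp_all add: amult_simps algebra_simps)
qed

section \<open>Bases of three-dimensional algebras\<close>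

lemma (in assoc_algebra) algebra_linear_mult:
  shows "mul (x + y) z = mul x z + mul y z" and "mul z (x + y) = mul z x + mul z y"
    and "mul (smul k x) z = smul k (mul x z)" and "mul z (smul k x) = smul k (mul z x)"
  using linear_mult_left[of z] linear_mult_right[of z] by (simp_all add: Vector_Spaces.linear_iff)

locale algebra_dim3 = assoc_algebra smul mul
  for smul :: "'k::field_char_0 \<Rightarrow> 'a::ab_group_add \<Rightarrow> 'a" (infixr "\<cdot>" 75)
    and mul :: "'a \<Rightarrow> 'a \<Rightarrow> 'a" (infixl "\<odot>" 70) +
  assumes dim_eq_3: "dim UNIV = 3"

lemma algebra_dim3_iff: "algebra_dim3 smul mul \<longleftrightarrow> algebra3 smul mul"
  by (simp add: algebra_dim3_def algebra_dim3_axioms_def algebra3_def)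

context algebra_dim3
begin

lemma mul_zero [simp]: "0 \<odot> x = 0" "x \<odot> 0 = 0"
  using algebra_linear_mult(3)[of 0 0 x] algebra_linear_mult(4)[of x 0 0] by simp_all

lemma mul_minus: "(- x) \<odot> y = - (x \<odot> y)" "x \<odot> (- y) = - (x \<odot> y)"
  using algebra_linear_mult(3)[of "-1" x y] algebra_linear_mult(4)[of x "-1" y] by simp_all

lemma mul_diff: "(x - y) \<odot> z = x \<odot> z - y \<odot> z" "z \<odot> (x - y) = z \<odot> x - z \<odot> y"
  using algebra_linear_mult(1)[of x "- y" z] algebra_linear_mult(2)[of z x "- y"]
  by (simp_all add: mul_minus)

lemmas mul_simps = algebra_linear_mult mul_minus mul_diff

text \<open>Independence of a list of three vectors, so that repeated entries count as dependent;
  \<open>indep3_iff\<close> relates it to independence of the set of entries.\<close>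
definition indep3 :: "'a \<Rightarrow> 'a \<Rightarrow> 'a \<Rightarrow> bool" where
  "indep3 u v w \<longleftrightarrow> (\<forall>a b c. a \<cdot> u + b \<cdot> v + c \<cdot> w = 0 \<longrightarrow> a = 0 \<and> b = 0 \<and> c = 0)"

lemma indep3I:
  "(\<And>a b c. a \<cdot> u + b \<cdot> v + c \<cdot> w = 0 \<Longrightarrow> a = 0 \<and> b = 0 \<and> c = 0) \<Longrightarrow> indep3 u v w"
  by (auto simp: indep3_def)

lemma indep3D: "indep3 u v w \<Longrightarrow> a \<cdot> u + b \<cdot> v + c \<cdot> w = 0 \<Longrightarrow> a = 0 \<and> b = 0 \<and> c = 0"
  by (simp add: indep3_def)

lemma indep3_iff: "indep3 u v w \<longleftrightarrow> independent {u, v, w} \<and> card {u, v, w} = 3"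
proof
  assume i: "indep3 u v w"
  have d: "u \<noteq> v" "u \<noteq> w" "v \<noteq> w"
    using indep3D[OF i, of 1 "-1" 0] indep3D[OF i, of 1 0 "-1"] indep3D[OF i, of 0 1 "-1"]
    by auto
  moreover have "f u = 0 \<and> f v = 0 \<and> f w = 0" if "(\<Sum>x\<in>{u, v, w}. f x \<cdot> x) = 0" for f
    using d that by (intro indep3D[OF i]) (simp add: add.assoc)
  then have "independent {u, v, w}"
    unfolding dependent_finite[of "{u, v, w}", simplified] by blast
  ultimately show "independent {u, v, w} \<and> card {u, v, w} = 3"
    by simp
next
  assume a: "independent {u, v, w} \<and> card {u, v, w} = 3"
  then have d: "u \<noteq> v" "u \<noteq> w" "v \<noteq> w"
    by (auto simp: card_insert_if split: if_splits)
  show "indep3 u v w"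
  proof (rule indep3I)
    fix p q r assume "p \<cdot> u + q \<cdot> v + r \<cdot> w = 0"
    moreover define f where "f = (\<lambda>x. if x = u then p else if x = v then q else r)"
    ultimately have "(\<Sum>x\<in>{u, v, w}. f x \<cdot> x) = 0"
      using d by (auto simp: add_ac)
    then have "\<forall>x\<in>{u, v, w}. f x = 0"
      using a by (simp add: dependent_finite) blast
    then show "p = 0 \<and> q = 0 \<and> r = 0"
      using d by (auto simp: f_def)
  qed
qed

lemma indep3_swap: "indep3 u v w \<Longrightarrow> indep3 u w v"
  by (simp add: indep3_iff insert_commute)

lemma independent_UNIV_span:
  assumes "independent B" "card B = 3"
  shows "span B = UNIV"
proof -
  obtain C where C: "B \<subseteq> C" "independent C" "UNIV \<subseteq> span C"
    by (rule maximal_independent_subset_extend[OF subset_UNIV assms(1)])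
  then have "card C = 3"
    using basis_card_eq_dim[of C UNIV] dim_eq_3 by simp
  moreover from this have "finite C"
    by (metis card.infinite zero_neq_numeral)
  ultimately have "B = C"
    using C(1) assms(2) card_subset_eq by metis
  then show ?thesis using C(3) by auto
qed

lemma indep3_expand:
  assumes "indep3 u v w" obtains a b c where "x = a \<cdot> u + b \<cdot> v + c \<cdot> w"
proof -
  have "x \<in> span {u, v, w}"
    using assms independent_UNIV_span by (auto simp: indep3_iff)
  then obtain a b c where "x - a \<cdot> u - b \<cdot> v - c \<cdot> w = 0"
    by (auto simp: span_insert)
  then show thesis by (intro that[of a b c]) (simp add: algebra_simps)
qed

text \<open>The new basis vectors can be chosen in any prescribed spanning set \<^term>\<open>V\<close>. Below, this
  produces bases of joint eigenvectors of the multiplications by an idempotent.\<close>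
lemma extend_to_indep3:
  assumes S: "S \<subseteq> V" "independent S" and V: "span V = UNIV"
  obtains B where "S \<subseteq> B" "B \<subseteq> V" "independent B" "card B = 3"
proof -
  obtain B where B: "S \<subseteq> B" "B \<subseteq> V" "independent B" "V \<subseteq> span B"
    by (rule maximal_independent_subset_extend[OF S])
  then have "UNIV \<subseteq> span B"
    using V by (metis span_minimal subspace_span)
  then have "card B = 3"
    using basis_card_eq_dim[of B UNIV] B(3) dim_eq_3 by simp
  with B show thesis using that by blast
qed

lemma extend_to_indep3_1:
  assumes "u \<in> V" "u \<noteq> 0" "span V = UNIV"
  obtains v w where "indep3 u v w" "v \<in> V" "w \<in> V"
proof -
  have "{u} \<subseteq> V" "independent {u}" using assms by auto
  then obtain B where B: "{u} \<subseteq> B" "B \<subseteq> V" "independent B" "card B = 3"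
    using extend_to_indep3 assms(3) by metis
  then have "card (B - {u}) = 2" by simp
  then obtain v w where "B - {u} = {v, w}" by (meson card_2_iff)
  then have "B = {u, v, w}" using B(1) by auto
  then show thesis using that[of v w] B by (auto simp: indep3_iff)
qed

lemma extend_to_indep3_2:
  assumes "u \<in> V" "v \<in> V" "span V = UNIV"
    and i: "\<And>a b. a \<cdot> u + b \<cdot> v = 0 \<Longrightarrow> a = 0 \<and> b = 0"
  obtains w where "indep3 u v w" "w \<in> V"
proof -
  have "u \<noteq> v" using i[of 1 "-1"] by auto
  moreover have "independent {u, v}"
    using \<open>u \<noteq> v\<close> i by (auto simp: dependent_finite)
  ultimately obtain B where B: "{u, v} \<subseteq> B" "B \<subseteq> V" "independent B" "card B = 3"
    using extend_to_indep3[of "{u, v}" V] assms by auto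
  then have "card (B - {u, v}) = 1" using \<open>u \<noteq> v\<close>
    by (subst card_Diff_subset) auto
  then obtain w where "B - {u, v} = {w}" by (meson card_1_singletonE)
  then have "B = {u, v, w}" using B(1) by auto
  then show thesis using that[of w] B by (auto simp: indep3_iff)
qed

end

text \<open>A fixed basis and the coordinates \<open>crd\<close> it defines. Since \<open>crd\<close> is linear, an equation between
  products of linear combinations becomes, once the products of the basis vectors are known, a
  system of equations between scalars. All structure constants below are found in this way.\<close>
locale based_algebra = algebra_dim3 smul mul
  for smul :: "'k::field_char_0 \<Rightarrow> 'a::ab_group_add \<Rightarrow> 'a" (infixr "\<cdot>" 75)
    and mul :: "'a \<Rightarrow> 'a \<Rightarrow> 'a" (infixl "\<odot>" 70) +
  fixes u v w :: 'a
  assumes indep: "indep3 u v w"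
begin

definition crd :: "'a \<Rightarrow> 'k^3" where
  "crd x = (SOME p. x = (p $ 1) \<cdot> u + (p $ 2) \<cdot> v + (p $ 3) \<cdot> w)"

lemma crd_expand: "x = (crd x $ 1) \<cdot> u + (crd x $ 2) \<cdot> v + (crd x $ 3) \<cdot> w"
proof -
  obtain a b c where "x = a \<cdot> u + b \<cdot> v + c \<cdot> w"
    using indep3_expand[OF indep] by metis
  then have "\<exists>p::'k^3. x = (p $ 1) \<cdot> u + (p $ 2) \<cdot> v + (p $ 3) \<cdot> w"
    by (intro exI[of _ "vec3 a b c"]) simp
  then show ?thesis
    unfolding crd_def by (rule someI_ex)
qed

lemma crd_unique: "crd (a \<cdot> u + b \<cdot> v + c \<cdot> w) = vec3 a b c"
proof -
  define p where "p = crd (a \<cdot> u + b \<cdot> v + c \<cdot> w)"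
  have "a \<cdot> u + b \<cdot> v + c \<cdot> w = (p $ 1) \<cdot> u + (p $ 2) \<cdot> v + (p $ 3) \<cdot> w"
    unfolding p_def by (rule crd_expand)
  then have "(p $ 1 - a) \<cdot> u + (p $ 2 - b) \<cdot> v + (p $ 3 - c) \<cdot> w = 0"
    by (simp add: algebra_simps)
  from indep3D[OF indep this] show ?thesis
    by (simp add: vec_eq_iff forall_3 flip: p_def)
qed

lemma crd_eq_iff: "x = y \<longleftrightarrow> crd x = crd y"
proof
  assume eq: "crd x = crd y"
  have "x = (crd x $ 1) \<cdot> u + (crd x $ 2) \<cdot> v + (crd x $ 3) \<cdot> w"
    by (rule crd_expand)
  also have "\<dots> = y"
    unfolding eq by (rule crd_expand[symmetric])
  finally show "x = y" .
qed simp

lemma expand: obtains a b c where "x = a \<cdot> u + b \<cdot> v + c \<cdot> w"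
  using crd_expand that by blast

lemma crd_add: "crd (x + y) = crd x + crd y"
proof -
  obtain a b c a' b' c'
    where xy: "x = a \<cdot> u + b \<cdot> v + c \<cdot> w" "y = a' \<cdot> u + b' \<cdot> v + c' \<cdot> w"
    using expand by metis
  then have "x + y = (a + a') \<cdot> u + (b + b') \<cdot> v + (c + c') \<cdot> w"
    by (simp add: algebra_simps)
  then show ?thesis
    by (simp only: xy crd_unique vec3_arith)
qed

lemma crd_scale: "crd (k \<cdot> x) = k *s crd x"
proof -
  obtain a b c where x: "x = a \<cdot> u + b \<cdot> v + c \<cdot> w"
    by (rule expand)
  then have "k \<cdot> x = (k * a) \<cdot> u + (k * b) \<cdot> v + (k * c) \<cdot> w"
    by (simp add: algebra_simps)
  then show ?thesis
    by (simp only: x crd_unique vec3_arith)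
qed

lemma crd_diff: "crd (x - y) = crd x - crd y"
  using crd_add[of "x - y" y] by simp

lemma crd_minus: "crd (- x) = - crd x"
  using crd_scale[of "-1" x] by (simp add: vec_eq_iff)

lemma crd_zero: "crd 0 = vec3 0 0 0"
  using crd_unique[of 0 0 0] by simp

lemma crd_basis: "crd u = vec3 1 0 0" "crd v = vec3 0 1 0" "crd w = vec3 0 0 1"
  using crd_unique[of 1 0 0] crd_unique[of 0 1 0] crd_unique[of 0 0 1] by simp_all

lemmas crd_simps = mul_simps crd_add crd_scale crd_diff crd_minus crd_zero crd_basis

text \<open>The coordinate map of a basis is itself the isomorphism onto the table of that basis.\<close>
lemma isomorphic_tableI:
  assumes "\<And>i j. vec3 u v w $ i \<odot> vec3 u v w $ j =
      (T $ i $ j $ 1) \<cdot> u + (T $ i $ j $ 2) \<cdot> v + (T $ i $ j $ 3) \<cdot> w"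
  shows "algebra_isomorphic smul mul (*s) (table_mult T)"
proof -
  have lin: "Vector_Spaces.linear smul (*s) crd"
    unfolding Vector_Spaces.linear_iff
    by (auto simp: crd_add crd_scale vector_space_axioms vec.vector_space_axioms)
  have prod: "crd (vec3 u v w $ i \<odot> vec3 u v w $ j) = T $ i $ j" for i j
    by (simp add: assms crd_unique vec_eq_iff forall_3)
  have "crd (mul x y) = table_mult T (crd x) (crd y)" for x y
  proof -
    obtain a b c a' b' c' where "x = a \<cdot> u + b \<cdot> v + c \<cdot> w" "y = a' \<cdot> u + b' \<cdot> v + c' \<cdot> w"
      using expand by metis
    then show ?thesis
      using prod[of 1 1] prod[of 1 2] prod[of 1 3] prod[of 2 1] prod[of 2 2] prod[of 2 3]
        prod[of 3 1] prod[of 3 2] prod[of 3 3]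
      by (simp add: crd_simps table_mult_vec3 vec.scale_right_distrib algebra_simps)
  qed
  moreover have "bij crd"
  proof (rule bijI')
    show "crd x = crd y \<longleftrightarrow> x = y" for x y
      using crd_eq_iff by blast
    show "\<exists>x. p = crd x" for p
    proof -
      obtain a b c where "p = vec3 a b c" by (rule vec3_cases)
      then have "p = crd (a \<cdot> u + b \<cdot> v + c \<cdot> w)" by (simp add: crd_unique)
      then show ?thesis ..
    qed
  qed
  ultimately show ?thesis
    unfolding algebra_isomorphic_def using lin by blast
qed

end

lemmas (in algebra_dim3) isomorphic_tableI =
  based_algebra.isomorphic_tableI[OF based_algebra.intro[OF algebra_dim3_axioms based_algebra_axioms.intro]]

definition det3 :: "'k::comm_ring_1^3 \<Rightarrow> 'k^3 \<Rightarrow> 'k^3 \<Rightarrow> 'k" where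
  "det3 p q r = p $ 1 * (q $ 2 * r $ 3 - q $ 3 * r $ 2) - p $ 2 * (q $ 1 * r $ 3 - q $ 3 * r $ 1)
    + p $ 3 * (q $ 1 * r $ 2 - q $ 2 * r $ 1)"

text \<open>Cramer's rule: the determinant annihilates the coefficients of every relation.\<close>
lemma (in based_algebra) indep3_det:
  assumes "det3 (crd x) (crd y) (crd z) \<noteq> 0"
  shows "indep3 x y z"
proof (rule indep3I)
  obtain x1 x2 x3 y1 y2 y3 z1 z2 z3
    where xyz: "crd x = vec3 x1 x2 x3" "crd y = vec3 y1 y2 y3" "crd z = vec3 z1 z2 z3"
    by (metis vec3_cases)
  let ?d = "det3 (crd x) (crd y) (crd z)"
  fix a b c assume "a \<cdot> x + b \<cdot> y + c \<cdot> z = 0"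
  then have "a * x1 + b * y1 + c * z1 = 0" "a * x2 + b * y2 + c * z2 = 0" "a * x3 + b * y3 + c * z3 = 0"
    by (simp_all add: crd_eq_iff crd_simps xyz)
  then have "?d * a = 0" "?d * b = 0" "?d * c = 0"
    unfolding det3_def xyz by (simp_all) algebra+
  with assms show "a = 0 \<and> b = 0 \<and> c = 0"
    by simp
qed

lemma (in based_algebra) det3_eq_0: "\<not> indep3 x y z \<Longrightarrow> det3 (crd x) (crd y) (crd z) = 0"
  using indep3_det by blast

context algebra_dim3
begin

abbreviation iso :: "'k alg_name \<Rightarrow> bool" where
  "iso A \<equiv> algebra_isomorphic smul mul (*s) (amult A)"

lemma isoI:
  assumes "indep3 u v w"
    and "\<forall>i j. vec3 u v w $ i \<odot> vec3 u v w $ j =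
      (table A $ i $ j $ 1) \<cdot> u + (table A $ i $ j $ 2) \<cdot> v + (table A $ i $ j $ 3) \<cdot> w"
  shows "iso A"
  using isomorphic_tableI[OF assms(1)] assms(2) by blast

end

lemmas table_simps = forall_3 table_def axis3 Let_def

section \<open>Fields with square roots up to sign and roots of cubics\<close>

text \<open>The common ground of \<open>\<real>\<close> and \<open>\<complex>\<close> on which the existence half rests. Square roots up to sign
  normalise quadratic extensions and forms; the root of a cubic splits a cubic algebra.\<close>
class nearly_closed_field = field_char_0 +
  assumes square_up_to_sign: "\<exists>s. t = s * s \<or> t = - (s * s)"
    and cubic_has_root: "\<exists>r. r * r * r = a + b * r + c * (r * r)"

instance complex :: nearly_closed_field
proof
  fix t a b c :: complex
  show "\<exists>s. t = s * s \<or> t = - (s * s)"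
    by (metis power2_csqrt power2_eq_square)
  have "\<exists>r. poly [:- a, - b, - c, 1:] r = 0"
    by (intro fundamental_theorem_of_algebra) (simp add: constant_degree)
  then show "\<exists>r. r * r * r = a + b * r + c * (r * r)"
    by (simp add: algebra_simps)
qed

text \<open>A real cubic changes sign between \<open>- m\<close> and \<open>m\<close>, where \<open>m\<close> is one more than the sum of the
  absolute values of its lower coefficients.\<close>
instance real :: nearly_closed_field
proof
  fix t a b c :: real
  show "\<exists>s. t = s * s \<or> t = - (s * s)"
    by (metis abs_of_nonneg abs_of_neg linorder_not_le minus_minus real_sqrt_mult_self)
  define f where "f r = r * r * r - (a + b * r + c * (r * r))" for r
  define m where "m = 1 + \<bar>a\<bar> + \<bar>b\<bar> + \<bar>c\<bar>"
  have m: "m \<ge> 1"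
    by (simp add: m_def)
  then have mm: "m * m \<ge> m" "m * m \<ge> 1"
    by (auto simp: mult_mono' intro: order_trans[OF m])
  have "\<bar>a\<bar> \<le> \<bar>a\<bar> * (m * m)" "\<bar>b\<bar> * m \<le> \<bar>b\<bar> * (m * m)"
    using mult_left_mono[OF mm(2), of "\<bar>a\<bar>"] mult_left_mono[OF mm(1), of "\<bar>b\<bar>"] by simp_all
  moreover have "m * m * m = m * m + \<bar>a\<bar> * (m * m) + \<bar>b\<bar> * (m * m) + \<bar>c\<bar> * (m * m)"
    unfolding m_def by (simp add: algebra_simps)
  ultimately have "\<bar>a\<bar> + \<bar>b\<bar> * m + \<bar>c\<bar> * (m * m) \<le> m * m * m"
    using mm by linarith
  moreover have "\<bar>b * m\<bar> = \<bar>b\<bar> * m" "\<bar>c * (m * m)\<bar> = \<bar>c\<bar> * (m * m)"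
    using m by (simp_all add: abs_mult)
  ultimately have "f (- m) \<le> 0" "f m \<ge> 0"
    unfolding f_def by (simp_all; linarith)+
  then have "\<exists>r\<ge>- m. r \<le> m \<and> f r = 0"
    by (intro IVT') (use m in \<open>auto simp: f_def intro!: continuous_intros\<close>)
  then show "\<exists>r. r * r * r = a + b * r + c * (r * r)"
    by (auto simp: f_def)
qed

text \<open>The suffix \<open>ncf\<close> abbreviates nearly closed field.\<close>
locale algebra_over_ncf = algebra_dim3 smul mul
  for smul :: "'k::nearly_closed_field \<Rightarrow> 'a::ab_group_add \<Rightarrow> 'a" (infixr "\<cdot>" 75)
    and mul :: "'a \<Rightarrow> 'a \<Rightarrow> 'a" (infixl "\<odot>" 70)

locale based_algebra_over_ncf = algebra_over_ncf smul mul + based_algebra smul mul u v w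
  for smul :: "'k::nearly_closed_field \<Rightarrow> 'a::ab_group_add \<Rightarrow> 'a" (infixr "\<cdot>" 75)
    and mul :: "'a \<Rightarrow> 'a \<Rightarrow> 'a" (infixl "\<odot>" 70)
    and u v w

section \<open>Algebras with a unit\<close>

lemma (in algebra_over_ncf) rebase:
  assumes "indep3 x y z"
  shows "based_algebra_over_ncf smul mul x y z"
  using assms by unfold_locales

context based_algebra_over_ncf
begin

text \<open>The algebra is \<open>K \<times> K[w]\<close> with \<open>w\<^sup>2 = d\<close>. The second factor is a dual number algebra for
  \<open>d = 0\<close>, splits by the idempotents \<open>(1 \<plusminus> w / s) / 2\<close> for \<open>d = s\<^sup>2\<close>, and is \<open>K[\<i>]\<close> with
  \<open>\<i> = w / s\<close> for \<open>d = - s\<^sup>2\<close>.\<close>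
lemma sum_of_unital_line_and_plane:
  assumes "u \<odot> u = u" "u \<odot> v = 0" "u \<odot> w = 0" "v \<odot> u = 0" "w \<odot> u = 0"
    and "v \<odot> v = v" "v \<odot> w = w" "w \<odot> v = w" "w \<odot> w = d \<cdot> v"
  shows "\<exists>A. iso A"
proof -
  obtain s where s: "d = s * s \<or> d = - (s * s)"
    using square_up_to_sign by blast
  consider "s = 0" "d = 0" | "s \<noteq> 0" "d = s * s" | "s \<noteq> 0" "d = - (s * s)"
    using s by (cases "s = 0") auto
  then show ?thesis
  proof cases
    case 1
    then have "iso U3"
      by (intro isoI[OF indep]) (simp add: table_simps assms)
    then show ?thesis ..
  next
    case 2
    define f g where "f = (1 / 2) \<cdot> v + (1 / (2 * s)) \<cdot> w" and "g = (1 / 2) \<cdot> v - (1 / (2 * s)) \<cdot> w"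
    have "indep3 u f g"
      using 2 by (intro indep3_det) (simp add: f_def g_def det3_def crd_simps field_simps)
    then have "iso U2"
      by (rule isoI) (use 2 in \<open>simp add: table_simps crd_eq_iff f_def g_def assms crd_simps field_simps\<close>)
    then show ?thesis ..
  next
    case 3
    have "indep3 u v ((1 / s) \<cdot> w)"
      using 3 by (intro indep3_det) (simp add: det3_def crd_simps)
    then have "iso U2m"
      by (rule isoI) (use 3 in \<open>simp add: table_simps crd_eq_iff assms crd_simps field_simps\<close>)
    then show ?thesis ..
  qed
qed

text \<open>Here the algebra is \<open>K[v]\<close> with \<open>v (v\<^sup>2 - p v - q) = 0\<close>. If \<open>q\<close> is nonzero, the two factors are
  coprime and \<open>f = (v\<^sup>2 - p v) / q\<close> is the idempotent that cuts out the quadratic factor; shifting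
  \<open>v\<close> by \<open>p / 2\<close> inside this factor completes the square. If \<open>q = 0\<close> and \<open>p\<close> is nonzero, the
  idempotent \<open>v\<^sup>2 / p\<^sup>2\<close> belongs to the simple root \<open>p\<close>.\<close>
lemma unital_cubic:
  assumes unit: "\<And>x. u \<odot> x = x" "\<And>x. x \<odot> u = x"
    and vv: "v \<odot> v = w" and vw: "v \<odot> w = q \<cdot> v + p \<cdot> w"
  shows "\<exists>A. iso A"
proof -
  have wv: "w \<odot> v = q \<cdot> v + p \<cdot> w"
    using mult_assoc[of v v v] vv vw by simp
  have ww: "w \<odot> w = (p * q) \<cdot> v + (q + p * p) \<cdot> w"
    using mult_assoc[of v v w] by (simp add: vv vw mul_simps algebra_simps)
  note prods = unit vv vw wv ww
  note D = det3_def crd_simps field_simps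
  consider "q = 0" "p = 0" | "q = 0" "p \<noteq> 0" | "q \<noteq> 0" by blast
  then show ?thesis
  proof cases
    case 1
    then have "iso U4"
      by (intro isoI[OF indep]) (simp add: table_simps prods)
    then show ?thesis ..
  next
    case 2
    define e f g where "e = (1 / (p * p)) \<cdot> w" and "f = u - e" and "g = v - (1 / p) \<cdot> w"
    have "indep3 e f g"
      using 2 by (intro indep3_det) (simp add: e_def f_def g_def D)
    then have "iso U3"
      by (rule isoI) (use 2 in \<open>simp add: table_simps crd_eq_iff e_def f_def g_def prods D\<close>)
    then show ?thesis ..
  next
    case 3
    define f where "f = (1 / q) \<cdot> w - (p / q) \<cdot> v"
    define e g d where "e = u - f" and "g = v - (p / 2) \<cdot> f" and "d = q + p * p / 4"
    have i: "indep3 e f g"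
      using 3 by (intro indep3_det) (simp add: e_def f_def g_def D)
    have fv: "f \<odot> v = v" "v \<odot> f = v" "f \<odot> f = f" "v \<odot> v = q \<cdot> f + p \<cdot> v"
      using 3 by (simp_all add: crd_eq_iff f_def prods D)
    have "f \<odot> g = g" "g \<odot> f = g" "g \<odot> g = d \<cdot> f"
      by (simp_all add: g_def mul_simps fv) (simp_all add: d_def algebra_simps flip: scale_left_distrib)
    moreover from this have "e \<odot> e = e" "e \<odot> f = 0" "e \<odot> g = 0" "f \<odot> e = 0" "g \<odot> e = 0"
      by (simp_all add: e_def mul_simps unit fv)
    ultimately show ?thesis
      using based_algebra_over_ncf.sum_of_unital_line_and_plane[OF rebase[OF i]] fv(3)
      by blast
  qed
qed

text \<open>Associativity of the products \<open>v v w\<close>, \<open>v w w\<close> and \<open>w v v\<close> determines every structure constant in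
  terms of \<open>b\<close> and \<open>c\<close>: one gets \<open>v\<^sup>2 = c\<^sup>2\<close>, \<open>w\<^sup>2 = b\<^sup>2\<close> and \<open>(v - c) (w - b) = 0\<close>. If \<open>b\<close> or \<open>c\<close>
  is nonzero, the corresponding vector is, up to a factor, an involution that acts by \<open>1\<close> and \<open>- 1\<close> on
  the two sides of a square zero vector, as in the upper triangular matrices.\<close>
lemma unital_quadratic:
  assumes unit: "\<And>x. u \<odot> x = x" "\<And>x. x \<odot> u = x"
    and vv: "v \<odot> v = p \<cdot> u" and ww: "w \<odot> w = q \<cdot> u"
    and vw: "v \<odot> w = a \<cdot> u + b \<cdot> v + c \<cdot> w"
    and wv: "w \<odot> v = a' \<cdot> u - b \<cdot> v - c \<cdot> w"
  shows "\<exists>A. iso A"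
proof -
  have eqs: "a = - (b * c)" "a' = - (b * c)" "p = c * c" "q = b * b"
    using mult_assoc[of v v w] mult_assoc[of v w w] mult_assoc[of w v v]
    by (simp_all add: unit vv vw wv ww crd_eq_iff crd_simps eq_neg_iff_add_eq_0 algebra_simps)
  note prods = unit vv [unfolded eqs] vw [unfolded eqs] wv [unfolded eqs] ww [unfolded eqs]
  consider "b = 0" "c = 0" | "b \<noteq> 0" | "b = 0" "c \<noteq> 0" by blast
  then show ?thesis
  proof cases
    case 1
    then have "iso U0"
      by (intro isoI[OF indep]) (simp add: table_simps prods)
    then show ?thesis ..
  next
    case 2
    define f g where "f = v + (c / b) \<cdot> w" and "g = (1 / b) \<cdot> w"
    have "indep3 u f g"
      using 2 by (intro indep3_det) (simp add: f_def g_def det3_def crd_simps field_simps)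
    then have "iso U1"
      by (rule isoI) (use 2 in \<open>simp add: table_simps crd_eq_iff f_def g_def prods crd_simps field_simps\<close>)
    then show ?thesis ..
  next
    case 3
    have "indep3 u w ((- 1 / c) \<cdot> v)"
      using 3 by (intro indep3_det) (simp add: det3_def crd_simps)
    then have "iso U1"
      by (rule isoI) (use 3 in \<open>simp add: table_simps crd_eq_iff prods crd_simps field_simps\<close>)
    then show ?thesis ..
  qed
qed

end

section \<open>Peirce components of an idempotent\<close>

context algebra_over_ncf
begin

text \<open>If \<open>u, x, x\<^sup>2\<close> are independent for some \<open>x\<close>, subtracting a root of the minimal polynomial of \<open>x\<close>
  removes its constant term. Otherwise all elements are quadratic; completing squares gives
  \<open>v\<^sup>2, w\<^sup>2 \<in> K\<close>, and the dependence of \<open>u, x, x\<^sup>2\<close> at \<open>x = v \<plusminus> w\<close> forces \<open>v w + w v \<in> K\<close>.\<close>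
lemma unital_classified:
  assumes unit: "\<And>x. u \<odot> x = x" "\<And>x. x \<odot> u = x" and "u \<noteq> 0"
  shows "\<exists>A. iso A"
proof (cases "\<exists>x. indep3 u x (x \<odot> x)")
  case True
  then obtain x where x: "indep3 u x (x \<odot> x)" ..
  define y where "y = x \<odot> x"
  interpret X: based_algebra_over_ncf smul mul u x y
    using x unfolding y_def by (rule rebase)
  obtain a b c where xy: "x \<odot> y = a \<cdot> u + b \<cdot> x + c \<cdot> y"
    by (rule X.expand)
  then have yx: "y \<odot> x = a \<cdot> u + b \<cdot> x + c \<cdot> y"
    by (simp add: y_def mult_assoc)
  have xx: "x \<odot> x = y" by (simp add: y_def)
  obtain r where r: "r * r * r = a + b * r + c * (r * r)"
    using cubic_has_root by blast
  define v where "v = x - r \<cdot> u"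
  define w where "w = v \<odot> v"
  have "v \<odot> w = (b + 2 * c * r - 3 * (r * r)) \<cdot> v + (c - 3 * r) \<cdot> w"
    using r by (simp add: v_def w_def X.crd_eq_iff X.crd_simps unit xx xy yx) algebra
  moreover have "indep3 u v w"
    by (intro X.indep3_det) (simp add: det3_def v_def w_def X.crd_simps unit xx)
  ultimately show ?thesis
    using based_algebra_over_ncf.unital_cubic[OF rebase, of u v w] unit w_def by blast
next
  case False
  then have dep: "\<not> indep3 u x (x \<odot> x)" for x
    by blast
  obtain v0 w0 where "indep3 u v0 w0"
    using extend_to_indep3_1[of u UNIV] \<open>u \<noteq> 0\<close> by auto
  then interpret B0: based_algebra_over_ncf smul mul u v0 w0
    by (rule rebase)
  obtain a1 b1 c1 a2 b2 c2
    where vv0: "v0 \<odot> v0 = a1 \<cdot> u + b1 \<cdot> v0 + c1 \<cdot> w0" and ww0: "w0 \<odot> w0 = a2 \<cdot> u + b2 \<cdot> v0 + c2 \<cdot> w0"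
    using B0.expand by metis
  have "c1 = 0"
    using B0.det3_eq_0[OF dep[of v0]] by (simp add: det3_def vv0 B0.crd_simps)
  have "b2 = 0"
    using B0.det3_eq_0[OF dep[of w0]] by (simp add: det3_def ww0 B0.crd_simps)
  define v w where "v = v0 - (b1 / 2) \<cdot> u" and "w = w0 - (c2 / 2) \<cdot> u"
  have vv: "v \<odot> v = (a1 + b1 * b1 / 4) \<cdot> u" and ww: "w \<odot> w = (a2 + c2 * c2 / 4) \<cdot> u"
    using \<open>c1 = 0\<close> \<open>b2 = 0\<close>
    by (simp_all add: v_def w_def B0.crd_eq_iff B0.crd_simps unit vv0 ww0 field_simps)
  have "indep3 u v w"
    by (intro B0.indep3_det) (simp add: det3_def v_def w_def B0.crd_simps)
  then interpret B: based_algebra_over_ncf smul mul u v w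
    by (rule rebase)
  obtain a b c a' b' c'
    where vw: "v \<odot> w = a \<cdot> u + b \<cdot> v + c \<cdot> w" and wv: "w \<odot> v = a' \<cdot> u + b' \<cdot> v + c' \<cdot> w"
    using B.expand by metis
  have "b + b' = c + c'"
    using B.det3_eq_0[OF dep[of "v + w"]]
    by (simp add: det3_def vv ww vw wv B.crd_simps algebra_simps)
  moreover have "b + b' = - (c + c')"
    using B.det3_eq_0[OF dep[of "v - w"]]
    by (simp add: det3_def vv ww vw wv B.crd_simps algebra_simps eq_neg_iff_add_eq_0)
  ultimately have "2 * (c + c') = 0" "b + b' = c + c'"
    by (metis mult_2 add.right_inverse, metis)
  moreover from this(1) have "c + c' = 0"
    by (simp only: mult_eq_0_iff zero_neq_numeral) simp
  ultimately have "b' = - b" "c' = - c"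
    by (simp_all add: eq_neg_iff_add_eq_0 add.commute)
  then have "w \<odot> v = a' \<cdot> u - b \<cdot> v - c \<cdot> w"
    using wv by simp
  then show ?thesis
    by (rule B.unital_quadratic[OF unit vv ww vw])
qed

lemma opposite: "algebra_over_ncf smul (\<lambda>x y. y \<odot> x)"
  using dim_eq_3
  by unfold_locales (simp_all add: mul_simps mult_assoc)

text \<open>Right-handed cases are the left-handed ones in the opposite algebra, whose table is the
  transposed one.\<close>
lemma iso_opposite:
  assumes "algebra_isomorphic smul (\<lambda>x y. y \<odot> x) (*s) (amult A)"
    and "\<And>x y. amult A x y = amult B y x"
  shows "iso B"
  using assms unfolding algebra_isomorphic_def by metis

text \<open>The truth values \<^term>\<open>l\<close> and \<^term>\<open>r\<close> are the eigenvalues \<open>1\<close> and \<open>0\<close> of left and right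
  multiplication by \<^term>\<open>e\<close>. The names \<open>peirce_lr_lr\<close> below list the eigenvalues of \<^term>\<open>v\<close> and
  \<^term>\<open>w\<close>.\<close>
definition peirce :: "'a \<Rightarrow> bool \<Rightarrow> bool \<Rightarrow> 'a \<Rightarrow> bool" where
  "peirce e l r x \<longleftrightarrow> e \<odot> x = (if l then x else 0) \<and> x \<odot> e = (if r then x else 0)"

end

lemma amult_transposes:
  "amult W10 x y = amult W9 y x" "amult W7 x y = amult W8 y x" "amult W5 x y = amult W6 y x"
  "amult C3 x y = amult C4 y x"
proof -
  obtain a b c p q r where "x = vec3 a b c" "y = vec3 p q r"
    by (metis vec3_cases)
  then show "amult W10 x y = amult W9 y x" "amult W7 x y = amult W8 y x" "amult W5 x y = amult W6 y x"
    "amult C3 x y = amult C4 y x"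
    by (simp_all add: amult_simps algebra_simps)
qed

context based_algebra_over_ncf
begin

lemma unit_on_basis:
  assumes "e \<odot> u = u" "e \<odot> v = v" "e \<odot> w = w" "u \<odot> e = u" "v \<odot> e = v" "w \<odot> e = w"
  shows "e \<odot> x = x" "x \<odot> e = x"
proof -
  obtain a b c where "x = a \<cdot> u + b \<cdot> v + c \<cdot> w"
    by (rule expand)
  then show "e \<odot> x = x" "x \<odot> e = x"
    by (simp_all add: mul_simps assms)
qed

lemma unital_on_basis:
  assumes "e \<odot> u = u" "e \<odot> v = v" "e \<odot> w = w" "u \<odot> e = u" "v \<odot> e = v" "w \<odot> e = w"
  shows "\<exists>A. iso A"
proof (rule unital_classified)
  show "e \<noteq> 0"
    using assms(1) indep3D[OF indep, of 1 0 0] by auto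
qed (rule unit_on_basis[OF assms])+

text \<open>The corner spanned by \<open>u, v\<close> acts on the line of \<open>w\<close> from the left through a character. Replacing
  \<open>v\<close> by \<open>v - c\<^sub>1 u\<close>, which is in the kernel of the character, leaves \<open>v\<^sup>2 = d v\<close>: either \<open>v\<close> is
  nilpotent, or \<open>v / d\<close> is an idempotent that kills \<open>w\<close>.\<close>
lemma peirce_11_10:
  assumes uu: "u \<odot> u = u" and v: "peirce u True True v" and w: "peirce u True False w"
  shows "iso W10 \<or> iso W7"
proof -
  have vw: "u \<odot> v = v" "v \<odot> u = v" "u \<odot> w = w" "w \<odot> u = 0"
    using v w by (simp_all add: peirce_def)
  obtain a b c a1 b1 c1 where ex: "v \<odot> v = a \<cdot> u + b \<cdot> v + c \<cdot> w" "v \<odot> w = a1 \<cdot> u + b1 \<cdot> v + c1 \<cdot> w"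
    using expand by metis
  have "w \<odot> v = 0" "w \<odot> w = 0"
    using mult_assoc[of w u v] mult_assoc[of w u w] by (simp_all add: vw)
  note prods = uu vw ex this
  have "c = 0" "a1 = 0" "b1 = 0"
    using mult_assoc[of v v u] mult_assoc[of v w u] by (simp_all add: prods crd_eq_iff crd_simps)
  moreover from this have "a = c1 * c1 - b * c1"
    using mult_assoc[of v v w] by (simp add: prods crd_eq_iff crd_simps eq_diff_eq)
  ultimately have prods: "u \<odot> u = u" "u \<odot> v = v" "v \<odot> u = v" "u \<odot> w = w" "w \<odot> u = 0"
    "v \<odot> v = (c1 * c1 - b * c1) \<cdot> u + b \<cdot> v" "v \<odot> w = c1 \<cdot> w" "w \<odot> v = 0" "w \<odot> w = 0"
    using prods by simp_all
  show ?thesis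
  proof (cases "b = 2 * c1")
    case True
    have "indep3 (v - c1 \<cdot> u) u w"
      by (intro indep3_det) (simp add: det3_def crd_simps)
    then have "iso W10"
      by (rule isoI) (use True in \<open>simp add: table_simps crd_eq_iff prods crd_simps algebra_simps\<close>)
    then show ?thesis ..
  next
    case False
    define d where "d = b - 2 * c1"
    then have b: "b = d + 2 * c1" and "d \<noteq> 0"
      using False by simp_all
    define e where "e = (1 / d) \<cdot> (v - c1 \<cdot> u)"
    have "indep3 e w (u - e)"
      using \<open>d \<noteq> 0\<close> by (intro indep3_det) (simp add: e_def det3_def crd_simps field_simps)
    then have "iso W7"
      by (rule isoI) (use \<open>d \<noteq> 0\<close> in \<open>simp add: table_simps crd_eq_iff e_def prods b crd_simps field_simps\<close>)
    then show ?thesis ..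
  qed
qed

text \<open>The algebra is the product of the unital plane spanned by \<open>u, v\<close> and the line of \<open>w\<close>. It is
  unital as soon as \<open>w\<^sup>2\<close> is nonzero, and otherwise the plane decides, after completing the square.\<close>
lemma peirce_11_00:
  assumes uu: "u \<odot> u = u" and v: "peirce u True True v" and w: "peirce u False False w"
  shows "\<exists>A. iso A"
proof -
  have vw: "u \<odot> v = v" "v \<odot> u = v" "u \<odot> w = 0" "w \<odot> u = 0"
    using v w by (simp_all add: peirce_def)
  obtain a b c a1 b1 c1 where ex: "v \<odot> v = a \<cdot> u + b \<cdot> v + c \<cdot> w" "w \<odot> w = a1 \<cdot> u + b1 \<cdot> v + c1 \<cdot> w"
    using expand by metis
  have "w \<odot> v = 0" "v \<odot> w = 0"
    using mult_assoc[of w u v] mult_assoc[of v u w] by (simp_all add: vw)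
  note prods = uu vw ex this
  have "c = 0" "a1 = 0" "b1 = 0"
    using mult_assoc[of v v u] mult_assoc[of w w u] by (simp_all add: prods crd_eq_iff crd_simps)
  with prods have prods: "u \<odot> u = u" "u \<odot> v = v" "v \<odot> u = v" "u \<odot> w = 0" "w \<odot> u = 0"
    "v \<odot> v = a \<cdot> u + b \<cdot> v" "v \<odot> w = 0" "w \<odot> v = 0" "w \<odot> w = c1 \<cdot> w"
    by simp_all
  show ?thesis
  proof (cases "c1 = 0")
    case False
    then show ?thesis
      by (intro unital_on_basis[of "u + (1 / c1) \<cdot> w"]) (simp_all add: mul_simps prods)
  next
    case w: True
    define p where "p = a + b * b / 4"
    then have a: "a = p - b * b / 4" by simp
    obtain s where s: "p = s * s \<or> p = - (s * s)"
      using square_up_to_sign by blast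
    define x where "x t = t \<cdot> v - (t * b / 2) \<cdot> u" for t
    have i: "indep3 u (x t) w" if "t \<noteq> 0" for t
      using that by (intro indep3_det) (simp add: x_def det3_def crd_simps)
    have x: "u \<odot> x t = x t" "x t \<odot> u = x t" "x t \<odot> w = 0" "w \<odot> x t = 0" "x t \<odot> x t = (t * t * p) \<cdot> u" for t
      by (simp_all add: x_def crd_eq_iff prods a crd_simps field_simps)
    consider "s = 0" "p = 0" | "s \<noteq> 0" "p = s * s" | "s \<noteq> 0" "p = - (s * s)"
      using s by (cases "s = 0") auto
    then show ?thesis
    proof cases
      case 1
      have "iso S4"
        by (rule isoI[OF i[of 1]]) (use 1 w in \<open>simp_all add: table_simps x prods\<close>)
      then show ?thesis ..
    next
      case 2
      have "iso S3"
        by (rule isoI[OF i[of "1 / s"]]) (use 2 w in \<open>simp_all add: table_simps x prods\<close>)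
      then show ?thesis ..
    next
      case 3
      have "iso S3m"
        by (rule isoI[OF i[of "1 / s"]]) (use 3 w in \<open>simp_all add: table_simps x prods\<close>)
      then show ?thesis ..
    qed
  qed
qed

lemma peirce_10_10:
  assumes uu: "u \<odot> u = u" and v: "peirce u True False v" and w: "peirce u True False w"
  shows "iso C3"
proof -
  have vw: "u \<odot> v = v" "v \<odot> u = 0" "u \<odot> w = w" "w \<odot> u = 0"
    using v w by (simp_all add: peirce_def)
  have "v \<odot> x = 0" "w \<odot> x = 0" if "u \<odot> x = x" for x
    using that mult_assoc[of v u x] mult_assoc[of w u x] by (simp_all add: vw)
  note prods = uu vw this[OF vw(1)] this[OF vw(3)]
  have "indep3 v w u"
    by (intro indep3_det) (simp add: det3_def crd_simps)
  then show ?thesis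
    by (rule isoI) (simp add: table_simps prods)
qed

text \<open>The only product left open by the eigenvalues is \<open>v w \<in> K u\<close>; it vanishes because
  \<open>(v w) v = v (w v) = 0\<close>.\<close>
lemma peirce_10_01:
  assumes uu: "u \<odot> u = u" and v: "peirce u True False v" and w: "peirce u False True w"
  shows "iso C2"
proof -
  have vw: "u \<odot> v = v" "v \<odot> u = 0" "u \<odot> w = 0" "w \<odot> u = w"
    using v w by (simp_all add: peirce_def)
  obtain a b c a1 b1 c1 where ex: "v \<odot> w = a \<cdot> u + b \<cdot> v + c \<cdot> w" "w \<odot> v = a1 \<cdot> u + b1 \<cdot> v + c1 \<cdot> w"
    using expand by metis
  have "v \<odot> v = 0" "w \<odot> w = 0"
    using mult_assoc[of v u v] mult_assoc[of w u w] by (simp_all add: vw)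
  note prods = uu vw ex this
  have "b = 0" "c = 0" "a1 = 0" "b1 = 0" "c1 = 0"
    using mult_assoc[of v w u] mult_assoc[of u v w] mult_assoc[of u w v] mult_assoc[of w v u]
    by (simp_all add: prods crd_eq_iff crd_simps)
  moreover from this have "a = 0"
    using mult_assoc[of v w v] by (simp add: prods crd_eq_iff crd_simps)
  moreover have "indep3 v u w"
    by (intro indep3_det) (simp add: det3_def crd_simps)
  ultimately show ?thesis
    by (intro isoI) (auto simp add: table_simps prods)
qed

text \<open>Right multiplication by \<open>w\<close> is a scalar \<open>b\<close> on the line of \<open>v\<close>, and \<open>w\<^sup>2 = c\<^sub>1 w\<close> forces
  \<open>b\<^sup>2 = b c\<^sub>1\<close>. In the case \<open>b = c\<^sub>1\<close>, with \<open>c\<^sub>1\<close> nonzero, \<open>u + w / c\<^sub>1\<close> is a unit.\<close>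
lemma peirce_10_00:
  assumes uu: "u \<odot> u = u" and v: "peirce u True False v" and w: "peirce u False False w"
  shows "iso W5 \<or> iso W7 \<or> (\<exists>e. e \<noteq> 0 \<and> (\<forall>x. e \<odot> x = x \<and> x \<odot> e = x))"
proof -
  have vw: "u \<odot> v = v" "v \<odot> u = 0" "u \<odot> w = 0" "w \<odot> u = 0"
    using v w by (simp_all add: peirce_def)
  obtain a b c a1 b1 c1 where ex: "v \<odot> w = a \<cdot> u + b \<cdot> v + c \<cdot> w" "w \<odot> w = a1 \<cdot> u + b1 \<cdot> v + c1 \<cdot> w"
    using expand by metis
  have "v \<odot> v = 0" "w \<odot> v = 0"
    using mult_assoc[of v u v] mult_assoc[of w u v] by (simp_all add: vw)
  note prods = uu vw ex this
  have "a = 0" "c = 0" "a1 = 0" "b1 = 0"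
    using mult_assoc[of v w u] mult_assoc[of u v w] mult_assoc[of u w w]
    by (simp_all add: prods crd_eq_iff crd_simps)
  with prods have prods: "u \<odot> u = u" "u \<odot> v = v" "v \<odot> u = 0" "u \<odot> w = 0" "w \<odot> u = 0"
    "v \<odot> v = 0" "v \<odot> w = b \<cdot> v" "w \<odot> v = 0" "w \<odot> w = c1 \<cdot> w"
    by simp_all
  have b: "b * b = b * c1"
    using mult_assoc[of v w w] by (simp add: prods crd_eq_iff crd_simps)
  consider "c1 = 0" "b = 0" | "c1 \<noteq> 0" "b = 0" | "c1 \<noteq> 0" "b = c1"
    using b by (cases "c1 = 0") auto
  then show ?thesis
  proof cases
    case 1
    have "indep3 w v u"
      by (intro indep3_det) (simp add: det3_def crd_simps)
    then have "iso W5"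
      by (rule isoI) (use 1 in \<open>simp add: table_simps prods\<close>)
    then show ?thesis ..
  next
    case 2
    have "indep3 ((1 / c1) \<cdot> w) v u"
      using 2 by (intro indep3_det) (simp add: det3_def crd_simps)
    then have "iso W7"
      by (rule isoI) (use 2 in \<open>simp add: table_simps prods mul_simps\<close>)
    then show ?thesis by blast
  next
    case 3
    define e where "e = u + (1 / c1) \<cdot> w"
    have "e \<odot> x = x" "x \<odot> e = x" for x
      by (rule unit_on_basis; use 3 in \<open>simp add: e_def mul_simps prods\<close>)+
    moreover have "e \<noteq> 0"
      by (simp add: e_def crd_eq_iff crd_simps)
    ultimately show ?thesis by blast
  qed
qed

end

context algebra_over_ncf
begin

text \<open>The Peirce decomposition
  \<open>x = e x e + (e x - e x e) + (x e - e x e) + (x - e x - x e + e x e)\<close>.\<close>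
lemma peirce_span: 
  assumes "e \<odot> e = e"
  shows "span {x. \<exists>l r. peirce e l r x} = UNIV" (is "span ?H = _")
proof -
  have "x \<in> span ?H" for x
  proof -
    have ee: "e \<odot> (e \<odot> y) = e \<odot> y" for y
      by (metis assms mult_assoc)
    let ?a = "e \<odot> x \<odot> e"
    have "peirce e True True ?a" "peirce e True False (e \<odot> x - ?a)" "peirce e False True (x \<odot> e - ?a)"
      "peirce e False False (x - e \<odot> x - x \<odot> e + ?a)"
      by (simp_all add: peirce_def mul_simps mult_assoc assms ee)
    then have "?a + (e \<odot> x - ?a) + (x \<odot> e - ?a) + (x - e \<odot> x - x \<odot> e + ?a) \<in> span ?H"
      by (intro span_add span_base) blast+
    then show ?thesis by simp
  qed
  then show ?thesis by blast
qed

lemma power_relation: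
  obtains a b c d where "a \<noteq> 0 \<or> b \<noteq> 0 \<or> c \<noteq> 0 \<or> d \<noteq> 0"
    "a \<cdot> x + b \<cdot> y + c \<cdot> z + d \<cdot> t = 0"
proof (cases "indep3 x y z")
  case True
  then obtain a b c where "t = a \<cdot> x + b \<cdot> y + c \<cdot> z"
    by (rule indep3_expand)
  then show thesis
    by (intro that[of a b c "-1"]) simp_all
next
  case False
  then obtain a b c where "a \<noteq> 0 \<or> b \<noteq> 0 \<or> c \<noteq> 0" "a \<cdot> x + b \<cdot> y + c \<cdot> z = 0"
    by (auto simp: indep3_def)
  then show thesis
    by (intro that[of a b c 0]) simp_all
qed

text \<open>The lowest nonzero term of the relation between the powers gives \<open>x\<^sup>n = x\<^sup>n f\<close> for some \<open>n \<le> 3\<close> and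
  some polynomial \<open>f\<close> in \<open>x\<close> without constant term; then \<open>f\<^sup>n\<close> is a multiple of \<open>x\<^sup>n\<close>, hence fixed by
  \<open>f\<close>, hence idempotent. That the idempotent is a combination of powers of \<open>x\<close> keeps it
  inside any subalgebra that contains \<open>x\<close>.\<close>
lemma idempotent_among_powers:
  assumes "x \<odot> x \<odot> x \<odot> x \<noteq> 0"
  obtains e a b c d where "e \<noteq> 0" "e \<odot> e = e"
    "e = a \<cdot> x + b \<cdot> (x \<odot> x) + c \<cdot> (x \<odot> x \<odot> x) + d \<cdot> (x \<odot> x \<odot> x \<odot> x)"
proof -
  define x2 x3 x4 where "x2 = x \<odot> x" and "x3 = x2 \<odot> x" and "x4 = x3 \<odot> x"
  note defs = x2_def x3_def x4_def
  have assoc: "x \<odot> x2 = x3" "x \<odot> x3 = x4" "x2 \<odot> x2 = x4" "x \<odot> x = x2" "x2 \<odot> x = x3" "x3 \<odot> x = x4"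
    by (simp_all add: defs mult_assoc)
  have x4: "x4 \<noteq> 0"
    using assms by (simp add: defs)
  then have nz: "x \<noteq> 0" "x2 \<noteq> 0" "x3 \<noteq> 0"
    unfolding defs by (metis mul_zero)+
  obtain a b c d where abcd: "a \<noteq> 0 \<or> b \<noteq> 0 \<or> c \<noteq> 0 \<or> d \<noteq> 0"
    and rel: "a \<cdot> x + b \<cdot> x2 + c \<cdot> x3 + d \<cdot> x4 = 0"
    by (rule power_relation)
  consider "a \<noteq> 0" | "a = 0" "b \<noteq> 0" | "a = 0" "b = 0" "c \<noteq> 0" | "a = 0" "b = 0" "c = 0" "d \<noteq> 0"
    using abcd by blast
  then show thesis
  proof cases
    case 1
    define e where "e = (- b / a) \<cdot> x + (- c / a) \<cdot> x2 + (- d / a) \<cdot> x3"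
    have "a \<cdot> (e \<odot> x) = - (b \<cdot> x2 + c \<cdot> x3 + d \<cdot> x4)"
      using 1 by (simp add: e_def mul_simps assoc scale_right_distrib scale_right_diff_distrib)
    also have "\<dots> = a \<cdot> x"
      by (rule minus_unique) (use rel in \<open>simp add: algebra_simps\<close>)
    finally have "a \<cdot> (e \<odot> x) = a \<cdot> x" .
    then have ex: "e \<odot> x = x"
      using 1 by simp
    then have "e \<odot> x2 = x2" "e \<odot> x3 = x3"
      by (metis mult_assoc defs)+
    with ex have "e \<odot> (p \<cdot> x + q \<cdot> x2 + r \<cdot> x3) = p \<cdot> x + q \<cdot> x2 + r \<cdot> x3" for p q r
      by (simp add: mul_simps)
    from this[of "- b / a" "- c / a" "- d / a"] have "e \<odot> e = e"
      by (simp only: flip: e_def)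
    moreover have "e \<noteq> 0"
      using ex nz by auto
    ultimately show thesis
      using that[of e "- b / a" "- c / a" "- d / a" 0] by (simp add: e_def defs)
  next
    case 2
    define p q where "p = - c / b" and "q = - d / b"
    have "b \<cdot> (p \<cdot> x3 + q \<cdot> x4) = - (c \<cdot> x3 + d \<cdot> x4)"
      using 2 by (simp add: p_def q_def scale_right_distrib scale_right_diff_distrib)
    also have "\<dots> = b \<cdot> x2"
      by (rule minus_unique) (use rel 2 in \<open>simp add: algebra_simps\<close>)
    finally have "b \<cdot> x2 = b \<cdot> (p \<cdot> x3 + q \<cdot> x4)" by (rule sym)
    then have x2: "x2 = p \<cdot> x3 + q \<cdot> x4"
      by (rule scale_left_imp_eq[OF 2(2)])
    define f where "f = p \<cdot> x + q \<cdot> x2"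
    have "x2 \<odot> f = p \<cdot> x3 + q \<cdot> x4"
      by (simp add: f_def mul_simps assoc)
    also have "\<dots> = x2"
      by (rule x2 [symmetric])
    finally have fx: "x2 \<odot> f = x2" .
    then have "x3 \<odot> f = x3" "x4 \<odot> f = x4"
      by (metis mult_assoc assoc)+
    moreover have ff: "f \<odot> f = (p * p) \<cdot> x2 + (2 * p * q) \<cdot> x3 + (q * q) \<cdot> x4"
      by (simp add: f_def mul_simps assoc algebra_simps flip: scale_left_distrib)
    ultimately have "f \<odot> f \<odot> f = f \<odot> f"
      by (simp add: mul_simps fx)
    then have "f \<odot> f \<odot> (f \<odot> f) = f \<odot> f"
      by (metis mult_assoc)
    moreover have "f \<odot> f \<noteq> 0"
      using fx nz by (metis mult_assoc mul_zero(2))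
    ultimately show thesis
      using that[of "f \<odot> f" 0 "p * p" "2 * p * q" "q * q"] ff by (simp add: defs)
  next
    case 3
    define p where "p = - d / c"
    have "c \<cdot> (p \<cdot> x4) = - (d \<cdot> x4)"
      using 3 by (simp add: p_def)
    also have "\<dots> = c \<cdot> x3"
      by (rule minus_unique) (use rel 3 in \<open>simp add: algebra_simps\<close>)
    finally have "c \<cdot> x3 = c \<cdot> (p \<cdot> x4)" by (rule sym)
    then have x3: "x3 = p \<cdot> x4"
      by (rule scale_left_imp_eq[OF 3(3)])
    define f e where "f = p \<cdot> x" and "e = (p * p * p) \<cdot> x3"
    have e: "e = f \<odot> f \<odot> f"
      by (simp add: e_def f_def mul_simps assoc mult.assoc)
    have "x3 \<odot> f = p \<cdot> x4"
      by (simp add: f_def mul_simps assoc)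
    also have "\<dots> = x3"
      by (rule x3 [symmetric])
    finally have "x3 \<odot> f = x3" .
    then have x3e: "x3 \<odot> e = x3"
      by (simp add: e flip: mult_assoc)
    then have "(k \<cdot> x3) \<odot> e = k \<cdot> x3" for k
      by (simp add: mul_simps)
    from this[of "p * p * p"] have "e \<odot> e = e"
      by (simp only: flip: e_def)
    moreover have "e \<noteq> 0"
      using x3e nz by auto
    ultimately show thesis
      using that[of e 0 0 "p * p * p" 0] by (simp add: e_def defs)
  next
    case 4
    then show thesis
      using rel x4 by simp
  qed
qed

text \<open>A second vector in the corner of \<open>e\<close> leaves four possible types for the third basis vector, one of
  which is the mirror image of another.\<close>
lemma classified_if_corner_dim_ge_2:
  assumes ee: "e \<odot> e = e" and y: "peirce e True True y"
    and i: "\<And>a b. a \<cdot> e + b \<cdot> y = 0 \<Longrightarrow> a = 0 \<and> b = 0"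
  shows "\<exists>A. iso A"
proof -
  let ?H = "{x. \<exists>l r. peirce e l r x}"
  have "peirce e True True e" using ee by (simp add: peirce_def)
  then obtain z where z: "indep3 e y z" "z \<in> ?H"
    using extend_to_indep3_2[of e ?H y] y i peirce_span[OF ee] by blast
  then interpret B: based_algebra_over_ncf smul mul e y z
    by (intro rebase)
  interpret O: algebra_over_ncf smul "\<lambda>x y. y \<odot> x"
    by (rule opposite)
  interpret BO: based_algebra_over_ncf smul "\<lambda>x y. y \<odot> x" e y z
    by (rule O.rebase[OF z(1)])
  have op: "O.peirce e l r x \<longleftrightarrow> peirce e r l x" for l r x
    by (auto simp: peirce_def O.peirce_def)
  obtain l r where lr: "peirce e l r z"
    using z by blast
  consider "l" "r" | "l" "\<not> r" | "\<not> l" "r" | "\<not> l" "\<not> r" by blast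
  then show ?thesis
  proof cases
    case 1
    then show ?thesis
      using B.unital_on_basis[of e] ee y lr by (simp add: peirce_def)
  next
    case 2
    then show ?thesis
      using B.peirce_11_10[OF ee y] lr by auto
  next
    case 3
    then have "O.iso W10 \<or> O.iso W7"
      using BO.peirce_11_10[of] ee y lr by (simp add: op)
    then show ?thesis
      using iso_opposite amult_transposes by metis
  next
    case 4
    then show ?thesis
      using B.peirce_11_00[OF ee y] lr by simp
  qed
qed

lemma square_zero_anticommute:
  assumes "x \<odot> x = 0" "y \<odot> y = 0" "(x + y) \<odot> (x + y) = 0"
  shows "y \<odot> x = - (x \<odot> y)"
  using assms by (simp add: mul_simps eq_neg_iff_add_eq_0 add.commute)

end

text \<open>The vectors annihilated by \<open>u\<close> on both sides form a subalgebra \<open>N\<close>, the plane of \<open>v, w\<close>. An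
  idempotent \<open>f\<close> in \<open>N\<close> gives the idempotent \<open>u + f\<close>, whose corner contains \<open>u\<close> as well. If \<open>N\<close> has
  none, it is nil, and being a plane it is either spanned by \<open>x, x\<^sup>2\<close> with \<open>x\<^sup>3 = 0\<close> or has zero
  product.\<close>
lemma (in based_algebra_over_ncf) peirce_00_00:
  assumes uu: "u \<odot> u = u" and v: "peirce u False False v" and w: "peirce u False False w"
  shows "\<exists>A. iso A"
proof -
  have vw: "u \<odot> v = 0" "v \<odot> u = 0" "u \<odot> w = 0" "w \<odot> u = 0"
    using v w by (simp_all add: peirce_def)
  define N where "N = {x. u \<odot> x = 0 \<and> x \<odot> u = 0}"
  have N: "x \<odot> y \<in> N" if "x \<in> N" "y \<in> N" for x y
    using that by (simp add: N_def mult_assoc) (metis mult_assoc mul_zero)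
  have N': "x + y \<in> N" if "x \<in> N" "y \<in> N" for x y
    using that by (simp add: N_def mul_simps)
  have N'': "k \<cdot> x \<in> N" if "x \<in> N" for x k
    using that by (simp add: N_def mul_simps)
  have uN: "a = 0" if "a \<cdot> u + x = 0" "x \<in> N" for a x
  proof -
    have "u \<odot> (a \<cdot> u + x) = a \<cdot> u" using that(2) by (simp add: mul_simps uu N_def)
    then show ?thesis using that(1) indep3D[OF indep, of a 0 0] by simp
  qed
  show ?thesis
  proof (cases "\<exists>x\<in>N. x \<odot> x \<odot> x \<odot> x \<noteq> 0")
    case True
    then obtain x where x: "x \<in> N" "x \<odot> x \<odot> x \<odot> x \<noteq> 0" by blast
    then obtain f a b c d where f: "f \<noteq> 0" "f \<odot> f = f" and
      fx: "f = a \<cdot> x + b \<cdot> (x \<odot> x) + c \<cdot> (x \<odot> x \<odot> x) + d \<cdot> (x \<odot> x \<odot> x \<odot> x)"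
      using idempotent_among_powers by metis
    have "f \<in> N"
      unfolding fx by (intro N N' N'' x)
    then have uf: "u \<odot> f = 0" "f \<odot> u = 0" by (auto simp: N_def)
    show ?thesis
    proof (rule classified_if_corner_dim_ge_2[of "u + f" u])
      fix a b assume "a \<cdot> (u + f) + b \<cdot> u = 0"
      then have *: "(a + b) \<cdot> u + a \<cdot> f = 0" by (simp add: algebra_simps)
      then have "a + b = 0" using uN N'' \<open>f \<in> N\<close> by blast
      with * have "a = 0" using f by simp
      with \<open>a + b = 0\<close> show "a = 0 \<and> b = 0" by simp
    qed (simp_all add: mul_simps peirce_def uu uf f)
  next
    case nil: False
    show ?thesis
    proof (cases "\<exists>x\<in>N. x \<odot> x \<noteq> 0")
      case True
      then obtain x where x: "x \<in> N" "x \<odot> x \<noteq> 0" by blast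
      define x2 x3 where "x2 = x \<odot> x" and "x3 = x2 \<odot> x"
      have assoc: "x \<odot> x2 = x3" "x \<odot> x = x2" "x2 \<odot> x = x3"
        by (simp_all add: x2_def x3_def mult_assoc)
      have x4: "x3 \<odot> x = 0" "x2 \<odot> x2 = 0" "x \<odot> x3 = 0"
        using nil x by (auto simp: x2_def x3_def mult_assoc)
      have xN: "x \<in> N" "x2 \<in> N" "x3 \<in> N"
        using x N by (auto simp: x2_def x3_def)
      have "x3 = 0"
      proof (rule ccontr)
        assume "x3 \<noteq> 0"
        have "indep3 x x2 x3"
        proof (rule indep3I)
          fix a b c assume 0: "a \<cdot> x + b \<cdot> x2 + c \<cdot> x3 = 0"
          then have "x2 \<odot> (a \<cdot> x + b \<cdot> x2 + c \<cdot> x3) = 0" by simp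
          then have "a = 0"
            using \<open>x3 \<noteq> 0\<close> by (simp add: mul_simps assoc x4) (metis assoc(2) mult_assoc x4(3) mul_zero scale_eq_0_iff add.right_neutral scale_zero_right)
          moreover from this 0 have "x \<odot> (b \<cdot> x2 + c \<cdot> x3) = 0" by simp
          then have "b = 0"
            using \<open>x3 \<noteq> 0\<close> by (simp add: mul_simps assoc x4)
          ultimately show "a = 0 \<and> b = 0 \<and> c = 0"
            using 0 \<open>x3 \<noteq> 0\<close> by simp
        qed
        then obtain a b c where "u = a \<cdot> x + b \<cdot> x2 + c \<cdot> x3"
          by (rule indep3_expand)
        then have "u \<in> N" by (metis N' N'' xN)
        then have "u = 0" using uu by (simp add: N_def)
        then show False using indep3D[OF indep, of 1 0 0] by simp
      qed
      have "indep3 u x x2"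
      proof (rule indep3I)
        fix a b c assume 0: "a \<cdot> u + b \<cdot> x + c \<cdot> x2 = 0"
        then have "a = 0"
          using uN[of a "b \<cdot> x + c \<cdot> x2"] xN N' N'' by (simp add: add.assoc)
        moreover from this 0 have "x \<odot> (b \<cdot> x + c \<cdot> x2) = 0" by simp
        then have "b = 0"
          using x by (simp add: mul_simps assoc \<open>x3 = 0\<close>)
        ultimately show "a = 0 \<and> b = 0 \<and> c = 0"
          using 0 x by (simp add: x2_def)
      qed
      then have "iso S2"
        by (rule isoI) (use xN in \<open>simp add: table_simps N_def uu assoc x4 \<open>x3 = 0\<close>\<close>)
      then show ?thesis ..
    next
      case False
      then have sq: "x \<odot> x = 0" if "x \<in> N" for x
        using that by blast
      have vwN: "v \<in> N" "w \<in> N" using vw by (auto simp: N_def)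
      obtain a b c where ex: "v \<odot> w = a \<cdot> u + b \<cdot> v + c \<cdot> w"
        by (rule expand)
      have "v \<odot> v = 0" "w \<odot> w = 0" "w \<odot> v = - (v \<odot> w)"
        using sq[OF vwN(1)] sq[OF vwN(2)] sq[OF N'[OF vwN]] square_zero_anticommute by auto
      note prods = uu vw this ex
      have "a = 0"
        using mult_assoc[of u v w] by (simp add: prods crd_eq_iff crd_simps)
      moreover from this have "b * c = 0" "c * c = 0" "b * b = 0"
        using mult_assoc[of v v w] mult_assoc[of v w w] by (simp_all add: prods crd_eq_iff crd_simps)
      ultimately have "v \<odot> w = 0" by (simp add: ex)
      then have "iso W4"
        by (intro isoI[OF indep]) (simp add: table_simps prods(1-8))
      then show ?thesis ..
    qed
  qed
qed

lemma (in algebra_over_ncf) classified_if_idempotent: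
  assumes ee: "e \<odot> e = e" and "e \<noteq> 0"
  shows "\<exists>A. iso A"
proof -
  let ?H = "{x. \<exists>l r. peirce e l r x}"
  have "peirce e True True e" using ee by (simp add: peirce_def)
  then obtain v w where vw: "indep3 e v w" "v \<in> ?H" "w \<in> ?H"
    using extend_to_indep3_1[of e ?H] \<open>e \<noteq> 0\<close> peirce_span[OF ee] by blast
  from vw(2) obtain l r where "peirce e l r v" by auto
  moreover from vw(3) obtain l' r' where "peirce e l' r' w" by auto
  ultimately have lr: "peirce e l r v" "peirce e l' r' w" by simp_all
  interpret B: based_algebra_over_ncf smul mul e v w
    using vw by (intro rebase)
  interpret B': based_algebra_over_ncf smul mul e w v
    by (rule rebase[OF indep3_swap[OF vw(1)]])
  interpret O: algebra_over_ncf smul "\<lambda>x y. y \<odot> x"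
    by (rule opposite)
  interpret BO: based_algebra_over_ncf smul "\<lambda>x y. y \<odot> x" e v w
    by (rule O.rebase[OF vw(1)])
  interpret BO': based_algebra_over_ncf smul "\<lambda>x y. y \<odot> x" e w v
    by (rule O.rebase[OF indep3_swap[OF vw(1)]])
  have op: "O.peirce e l r x \<longleftrightarrow> peirce e r l x" for l r x
    by (auto simp: peirce_def O.peirce_def)
  have corner: ?thesis if "peirce e True True v \<or> peirce e True True w"
  proof -
    have 1: "a = 0 \<and> b = 0" if "a \<cdot> e + b \<cdot> v = 0" for a b
      using indep3D[OF vw(1), of a b 0] that by simp
    have 2: "a = 0 \<and> b = 0" if "a \<cdot> e + b \<cdot> w = 0" for a b
      using indep3D[OF vw(1), of a 0 b] that by simp
    from that show ?thesis
      by (elim disjE; intro classified_if_corner_dim_ge_2[OF ee]) (assumption | rule 1 2 | assumption)+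
  qed
  have 00: ?thesis if "iso W5 \<or> iso W7 \<or> (\<exists>e. e \<noteq> 0 \<and> (\<forall>x. e \<odot> x = x \<and> x \<odot> e = x))"
    using that unital_classified by blast
  have 01: ?thesis if "O.iso W5 \<or> O.iso W7 \<or> (\<exists>e. e \<noteq> 0 \<and> (\<forall>x. x \<odot> e = x \<and> e \<odot> x = x))"
    using that unital_classified iso_opposite amult_transposes by metis
  show ?thesis
  proof (cases l; cases r; cases l'; cases r')
    assume "l" "\<not> r" "l'" "\<not> r'"
    then show ?thesis using B.peirce_10_10[OF ee] lr by auto
  next
    assume "l" "\<not> r" "\<not> l'" "r'"
    then show ?thesis using B.peirce_10_01[OF ee] lr by auto
  next
    assume "l" "\<not> r" "\<not> l'" "\<not> r'"
    then show ?thesis using B.peirce_10_00[OF ee] lr 00 by simp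
  next
    assume "\<not> l" "r" "l'" "\<not> r'"
    then show ?thesis using B'.peirce_10_01[OF ee] lr by auto
  next
    assume "\<not> l" "r" "\<not> l'" "r'"
    then have "O.iso C3" using BO.peirce_10_10 ee lr by (simp add: op)
    then show ?thesis using iso_opposite amult_transposes by metis
  next
    assume "\<not> l" "r" "\<not> l'" "\<not> r'"
    then show ?thesis using BO.peirce_10_00 ee lr 01 by (simp add: op)
  next
    assume "\<not> l" "\<not> r" "l'" "\<not> r'"
    then show ?thesis using B'.peirce_10_00[OF ee] lr 00 by simp
  next
    assume "\<not> l" "\<not> r" "\<not> l'" "r'"
    then show ?thesis using BO'.peirce_10_00 ee lr 01 by (simp add: op)
  next
    assume "\<not> l" "\<not> r" "\<not> l'" "\<not> r'"
    then show ?thesis using B.peirce_00_00[OF ee] lr by simp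
  qed (use lr corner in simp)+
qed

section \<open>Nil algebras\<close>

context based_algebra_over_ncf
begin

text \<open>All products are multiples of \<open>u\<close>, so the table is a bilinear form on the plane of \<open>v, w\<close>. For
  \<open>q\<close> nonzero, scaling \<open>w\<close> makes \<open>q = \<plusminus>1\<close>. For \<open>q = 0\<close> and \<open>k\<close> nonzero the form is a product of
  two independent linear forms, and \<open>v - w / k\<close> spans the kernel on one side.\<close>
lemma rank_one_product_normal_form:
  assumes "u \<odot> u = 0" "u \<odot> v = 0" "u \<odot> w = 0" "v \<odot> u = 0" "w \<odot> u = 0"
    and "v \<odot> v = u" "v \<odot> w = 0" "w \<odot> v = k \<cdot> u" "w \<odot> w = q \<cdot> u"
  shows "\<exists>A. iso A"
proof -
  obtain s where s: "q = s * s \<or> q = - (s * s)"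
    using square_up_to_sign by blast
  consider "q = 0" "k = 0" | "q = 0" "k \<noteq> 0" | "s \<noteq> 0" "q = s * s" | "s \<noteq> 0" "q = - (s * s)"
    using s by (cases "s = 0") auto
  then show ?thesis
  proof cases
    case 1
    have "indep3 u w v"
      by (rule indep3_swap[OF indep])
    then have "iso W1"
      by (rule isoI) (simp add: table_simps assms 1)
    then show ?thesis ..
  next
    case 2
    have "indep3 u (v - (1 / k) \<cdot> w) ((1 / k) \<cdot> w)"
      using 2 by (intro indep3_det) (simp add: det3_def crd_simps)
    then have "iso W2"
      by (rule isoI) (use 2 in \<open>simp add: table_simps mul_simps assms\<close>)
    then show ?thesis ..
  next
    case 3
    have "indep3 u v ((1 / s) \<cdot> w)"
      using 3 by (intro indep3_det) (simp add: det3_def crd_simps)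
    then have "iso (W3 (k / s))"
      by (rule isoI) (use 3 in \<open>simp add: table_simps mul_simps assms\<close>)
    then show ?thesis ..
  next
    case 4
    have "indep3 u v ((1 / s) \<cdot> w)"
      using 4 by (intro indep3_det) (simp add: det3_def crd_simps)
    then have "iso (W3m (k / s))"
      by (rule isoI) (use 4 in \<open>simp add: table_simps mul_simps assms\<close>)
    then show ?thesis ..
  qed
qed

text \<open>Multiplications by \<open>v\<close> and by \<open>w\<close> are nilpotent, so each eigenvalue that they exhibit on an
  invariant line or on a quotient vanishes. Removing these coefficients one after the other leaves
  only products in the line of \<open>u = v\<^sup>2\<close>, and \<open>z = w - a v\<close> is orthogonal to \<open>v\<close> from the right.\<close>
lemma square_of_nil_index_3:
  assumes nil: "\<And>x. x \<odot> x \<odot> x = 0" and vv: "v \<odot> v = u"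
  shows "\<exists>A. iso A"
proof -
  obtain a b c a1 b1 c1 d f g
    where vw: "v \<odot> w = a \<cdot> u + b \<cdot> v + c \<cdot> w" and wv: "w \<odot> v = a1 \<cdot> u + b1 \<cdot> v + c1 \<cdot> w"
      and ww: "w \<odot> w = d \<cdot> u + f \<cdot> v + g \<cdot> w"
    using expand by metis
  have u: "u \<odot> v = 0" "v \<odot> u = 0" "u \<odot> u = 0"
    using nil[of v] by (simp_all add: mult_assoc flip: vv)
  have "v \<odot> (v \<odot> (v \<odot> w)) = 0" "w \<odot> v \<odot> v \<odot> v = 0"
    using nil[of v] by (metis mult_assoc mul_zero)+
  then have "c = 0" "c1 = 0"
    by (simp_all add: vw wv vv u crd_eq_iff crd_simps)
  have uw: "u \<odot> w = b \<cdot> u" "w \<odot> u = b1 \<cdot> u"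
    using mult_assoc[of v v w] mult_assoc[of w v v] \<open>c = 0\<close> \<open>c1 = 0\<close>
    by (simp_all add: vv vw wv u mul_simps)
  have "u \<odot> w \<odot> w \<odot> w = 0" "w \<odot> (w \<odot> (w \<odot> u)) = 0"
    using nil[of w] by (metis mult_assoc mul_zero)+
  then have "b = 0" "b1 = 0"
    by (simp_all add: uw crd_eq_iff crd_simps)
  note prods = vv u vw wv uw ww \<open>c = 0\<close> \<open>c1 = 0\<close> \<open>b = 0\<close> \<open>b1 = 0\<close>
  have "g = 0"
    using nil[of w] by (simp add: mult_assoc) (simp add: prods crd_eq_iff crd_simps)
  then have "f = 0"
    using mult_assoc[of v w w] by (simp add: prods crd_eq_iff crd_simps)
  define z where "z = w - a \<cdot> v"
  have "indep3 u v z"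
    by (intro indep3_det) (simp add: z_def det3_def crd_simps)
  moreover have "v \<odot> z = 0" "z \<odot> v = (a1 - a) \<cdot> u" "z \<odot> z = (d - a * a1) \<cdot> u" "u \<odot> z = 0" "z \<odot> u = 0"
    using \<open>g = 0\<close> \<open>f = 0\<close> by (simp_all add: z_def prods crd_eq_iff crd_simps algebra_simps)
  ultimately show ?thesis
    using based_algebra_over_ncf.rank_one_product_normal_form[OF rebase, of u v z] u vv
    by blast
qed

end

context algebra_over_ncf
begin

lemma classified_if_nil_index_4:
  assumes x: "x \<odot> x \<odot> x \<noteq> 0" "x \<odot> x \<odot> x \<odot> x = 0"
  shows "iso S1"
proof -
  define x2 x3 where "x2 = x \<odot> x" and "x3 = x2 \<odot> x"
  have x3: "x3 \<noteq> 0" using x by (simp add: x2_def x3_def)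
  have assoc: "x \<odot> x = x2" "x \<odot> x2 = x3" "x2 \<odot> x = x3"
    by (simp_all add: x2_def x3_def mult_assoc)
  have zero: "x3 \<odot> x = 0" "x2 \<odot> x2 = 0" "x \<odot> x3 = 0"
    using x(2) by (simp_all add: x2_def x3_def mult_assoc)
  have more: "x2 \<odot> x3 = 0" "x3 \<odot> x2 = 0" "x3 \<odot> x3 = 0"
    using zero by (metis x3_def mult_assoc mul_zero x2_def)+
  have "indep3 x x2 x3"
  proof (rule indep3I)
    fix a b c assume 0: "a \<cdot> x + b \<cdot> x2 + c \<cdot> x3 = 0"
    then have "x2 \<odot> (a \<cdot> x + b \<cdot> x2 + c \<cdot> x3) = 0" by simp
    then have "a = 0"
      using x3 by (simp add: mul_simps assoc zero more)
    moreover from this 0 have "x \<odot> (b \<cdot> x2 + c \<cdot> x3) = 0" by simp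
    then have "b = 0"
      using x3 by (simp add: mul_simps assoc zero)
    ultimately show "a = 0 \<and> b = 0 \<and> c = 0"
      using 0 x3 by simp
  qed
  then show ?thesis
    by (rule isoI) (simp add: table_simps assoc zero more)
qed

lemma classified_if_nil_index_3:
  assumes nil: "\<And>x. x \<odot> x \<odot> x = 0" and x: "x \<odot> x \<noteq> 0"
  shows "\<exists>A. iso A"
proof -
  have i: "a = 0 \<and> b = 0" if 0: "a \<cdot> (x \<odot> x) + b \<cdot> x = 0" for a b
  proof -
    have "x \<odot> (a \<cdot> (x \<odot> x) + b \<cdot> x) = 0" using 0 by simp
    then have "b = 0"
      using nil[of x] x by (simp add: mul_simps mult_assoc)
    with 0 x show ?thesis by simp
  qed
  obtain y where "indep3 (x \<odot> x) x y"
    by (rule extend_to_indep3_2[OF UNIV_I UNIV_I _ i]) simp_all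
  then interpret B: based_algebra_over_ncf smul mul "x \<odot> x" x y
    by (rule rebase)
  show ?thesis
    by (rule B.square_of_nil_index_3[OF nil refl])
qed

text \<open>The product is anticommutative, so \<open>x\<close> and \<open>y\<close> both annihilate \<open>x y\<close>; if \<open>x y\<close> is nonzero, these
  three elements are independent and form the Heisenberg table.\<close>
lemma classified_if_nil_index_2:
  assumes nil: "\<And>x. x \<odot> x = 0"
  shows "\<exists>A. iso A"
proof (cases "\<exists>x y. x \<odot> y \<noteq> 0")
  case True
  then obtain x y where xy: "x \<odot> y \<noteq> 0" by blast
  define z where "z = x \<odot> y"
  have anti: "b \<odot> a = - (a \<odot> b)" for a b
    using nil by (intro square_zero_anticommute)
  have z: "x \<odot> z = 0" "z \<odot> y = 0"
    using nil[of x] nil[of y] by (simp_all add: z_def mult_assoc) (metis mult_assoc mul_zero)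
  then have "z \<odot> x = 0" "y \<odot> z = 0"
    using anti[of x z] anti[of z y] by simp_all
  note prods = nil z this
  have "indep3 z x y"
  proof (rule indep3I)
    fix a b c assume 0: "a \<cdot> z + b \<cdot> x + c \<cdot> y = 0"
    have "x \<odot> (a \<cdot> z + b \<cdot> x + c \<cdot> y) = c \<cdot> z" "(a \<cdot> z + b \<cdot> x + c \<cdot> y) \<odot> y = b \<cdot> z"
      by (simp_all add: mul_simps prods flip: z_def)
    then have "c \<cdot> z = 0" "b \<cdot> z = 0"
      unfolding 0 by simp_all
    then have "b = 0" "c = 0"
      using xy by (simp_all add: z_def)
    then show "a = 0 \<and> b = 0 \<and> c = 0"
      using xy 0 by (simp add: z_def)
  qed
  moreover have "x \<odot> y = z" "y \<odot> x = - z"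
    by (simp_all add: z_def anti[of x y])
  ultimately have "iso C1"
    by (intro isoI[of z x y]) (simp_all add: table_simps prods)
  then show ?thesis ..
next
  case False
  obtain B where B: "{} \<subseteq> B" "B \<subseteq> UNIV" "independent B" "card B = 3"
    by (rule extend_to_indep3[of "{}" UNIV]) (auto simp: independent_empty)
  then obtain u v w where "B = {u, v, w}" by (meson card_3_iff)
  then have "indep3 u v w" using B by (simp add: indep3_iff)
  then have "iso C0"
    by (rule isoI) (use False in \<open>simp add: table_simps\<close>)
  then show ?thesis ..
qed

theorem classified: "\<exists>A. iso A"
proof (cases "\<forall>x. x \<odot> x \<odot> x \<odot> x = 0")
  case False
  then show ?thesis
    using idempotent_among_powers classified_if_idempotent by metis
next
  case True
  then consider x where "x \<odot> x \<odot> x \<noteq> 0" "x \<odot> x \<odot> x \<odot> x = 0"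
    | x where "\<And>x. x \<odot> x \<odot> x = 0" "x \<odot> x \<noteq> 0" | "\<And>x. x \<odot> x = 0"
    by blast
  then show ?thesis
    by cases (use classified_if_nil_index_4 classified_if_nil_index_3 classified_if_nil_index_2 in blast)+
qed

end

section \<open>Unital, curled, straight and waved tables\<close>

lemma dependent_list_2:
  "dependent_list smul [x, y] \<longleftrightarrow> (\<exists>a b. (a \<noteq> 0 \<or> b \<noteq> 0) \<and> smul a x + smul b y = 0)" (is "_ = ?R")
proof
  assume "dependent_list smul [x, y]"
  then show ?R
    by (auto simp: dependent_list_def Ex_less_Suc)
next
  assume ?R
  then obtain a b where "a \<noteq> 0 \<or> b \<noteq> 0" "smul a x + smul b y = 0" by blast
  then show "dependent_list smul [x, y]"
    unfolding dependent_list_def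
    by (intro exI[of _ "\<lambda>i. if i = 0 then a else b"]) (auto simp: Ex_less_Suc)
qed

lemma dependent_list_3:
  "dependent_list smul [x, y, z] \<longleftrightarrow>
     (\<exists>a b c. (a \<noteq> 0 \<or> b \<noteq> 0 \<or> c \<noteq> 0) \<and> smul a x + smul b y + smul c z = 0)" (is "_ = ?R")
proof
  assume "dependent_list smul [x, y, z]"
  then show ?R
    by (auto simp: dependent_list_def Ex_less_Suc)
next
  assume ?R
  then obtain a b c where "a \<noteq> 0 \<or> b \<noteq> 0 \<or> c \<noteq> 0" "smul a x + smul b y + smul c z = 0" by blast
  then show "dependent_list smul [x, y, z]"
    unfolding dependent_list_def
    by (intro exI[of _ "\<lambda>i. if i = 0 then a else if i = 1 then b else c"]) (auto simp: Ex_less_Suc)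
qed

text \<open>A relation between \<open>x, x\<^sup>2\<close> is also one between \<open>x, x\<^sup>2, x\<^sup>3\<close>, so one witness excludes both
  curled and waved.\<close>
lemma straightI:
  assumes "\<not> dependent_list smul [x, mul x x, mul (mul x x) x]" and "\<And>x. smul 0 x = 0"
  shows "straight smul mul"
proof -
  have "\<not> dependent_list smul [x, mul x x]"
  proof
    assume "dependent_list smul [x, mul x x]"
    then obtain a b where "a \<noteq> 0 \<or> b \<noteq> 0" "smul a x + smul b (mul x x) + smul 0 (mul (mul x x) x) = 0"
      using assms(2) by (auto simp: dependent_list_2)
    then show False
      using assms(1) unfolding dependent_list_3 by blast
  qed
  then show ?thesis
    using assms(1) by (auto simp: straight_def curled_def waved_def)
qed

lemma unital_amult:
  fixes A :: "'k::field_char_0 alg_name"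
  shows "A \<in> {U0, U1, U2, U3, U4, U2m} \<Longrightarrow> unital (amult A)"
proof -
  have *: "unital (amult A)" if "\<And>a b c. amult A u (vec3 a b c) = vec3 a b c"
    "\<And>a b c. amult A (vec3 a b c) u = vec3 a b c" for A :: "'k alg_name" and u
    unfolding unital_def all_vec3 using that by blast
  show "A \<in> {U0, U1, U2, U3, U4, U2m} \<Longrightarrow> unital (amult A)"
    using *[of U0 "vec3 1 0 0"] *[of U1 "vec3 1 0 0"] *[of U2 "vec3 1 1 1"] *[of U3 "vec3 1 1 0"]
      *[of U4 "vec3 1 0 0"] *[of U2m "vec3 1 1 0"]
    by (auto simp: amult_simps)
qed

lemma not_unital_amult:
  fixes A :: "'k::field_char_0 alg_name"
  assumes "A \<notin> {U0, U1, U2, U3, U4, U2m}"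
  shows "\<not> unital (amult A)"
proof
  assume "unital (amult A)"
  then obtain a b c where
    "\<And>p q r. amult A (vec3 a b c) (vec3 p q r) = vec3 p q r \<and> amult A (vec3 p q r) (vec3 a b c) = vec3 p q r"
    unfolding unital_def ex_vec3 all_vec3 by blast
  from this[of 1 0 0] this[of 0 1 0] this[of 0 0 1] show False
    using assms by (cases A) (auto simp: amult_simps)
qed

text \<open>In each of these tables \<open>x\<^sup>2\<close> is zero or a multiple of \<open>x\<close> by one of its coordinates.\<close>
lemma curled_amult:
  fixes A :: "'k::field_char_0 alg_name"
  assumes "A \<in> {C0, C1, C2, C3, C4}"
  shows "curled (*s) (amult A)"
  unfolding curled_def all_vec3
proof (intro allI)
  fix a b c :: 'k
  show "dependent_list (*s) [vec3 a b c, amult A (vec3 a b c) (vec3 a b c)]"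
  proof -
    consider "A = C0" | "A = C1" | "A = C2" | "A = C3" | "A = C4" using assms by blast
    then show ?thesis
    proof cases
      case 1 then show ?thesis
        unfolding dependent_list_2 by (intro exI[of _ 0] exI[of _ 1]) (simp add: amult_simps)
    next
      case 2 then show ?thesis
        unfolding dependent_list_2 by (intro exI[of _ 0] exI[of _ 1]) (simp add: amult_simps)
    next
      case 3 then show ?thesis
        unfolding dependent_list_2 by (intro exI[of _ b] exI[of _ "- 1"]) (simp add: amult_simps)
    next
      case 4 then show ?thesis
        unfolding dependent_list_2 by (intro exI[of _ c] exI[of _ "- 1"]) (simp add: amult_simps)
    next
      case 5 then show ?thesis
        unfolding dependent_list_2 by (intro exI[of _ c] exI[of _ "- 1"]) (simp add: amult_simps)
    qed
  qed
qed

lemma straight_amult: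
  fixes A :: "'k::field_char_0 alg_name"
  assumes "A \<in> {S1, S2, S3, S4, S3m}"
  shows "straight (*s) (amult A)"
proof -
  have *: "straight (*s) (amult A)"
    if "\<And>a b c. a *s x + b *s amult A x x + c *s amult A (amult A x x) x = 0 \<Longrightarrow> a = 0 \<and> b = 0 \<and> c = 0" for x
    by (rule straightI[of _ x]) (use that in \<open>auto simp: dependent_list_3\<close>)
  consider "A = S1" | "A = S2" | "A = S3" | "A = S4" | "A = S3m" using assms by blast
  then show ?thesis
  proof cases
    case 1 then show ?thesis by (intro *[of "vec3 1 0 0"]) (auto simp: amult_simps)
  next
    case 2 then show ?thesis by (intro *[of "vec3 1 1 0"]) (auto simp: amult_simps)
  next
    case 3 then show ?thesis by (intro *[of "vec3 0 1 1"]) (auto simp: amult_simps)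
  next
    case 4 then show ?thesis by (intro *[of "vec3 1 1 1"]) (auto simp: amult_simps add_eq_0_iff)
  next
    case 5 then show ?thesis by (intro *[of "vec3 1 1 1"]) (auto simp: amult_simps)
  qed
qed

text \<open>Each table satisfies a cubic identity \<open>p x + q x\<^sup>2 + x\<^sup>3 = 0\<close> in which \<open>p\<close> and \<open>q\<close> are
  polynomials in the coordinates of \<open>x\<close>.\<close>
lemma waved_amult:
  fixes A :: "'k::field_char_0 alg_name"
  assumes "A \<in> {W1, W2, W4, W5, W6, W7, W8, W9, W10} \<union> range W3 \<union> range W3m"
  shows "waved (*s) (amult A)"
proof -
  have *: "waved (*s) (amult A)"
    if x: "\<And>a b. a *s x + b *s amult A x x = 0 \<Longrightarrow> a = 0 \<and> b = 0"
      and pq: "\<And>a b c. let y = vec3 a b c; y2 = amult A y y in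
        p a b c *s y + q a b c *s y2 + 1 *s amult A y2 y = 0"
    for A :: "'k alg_name" and x p q
  proof -
    have "dependent_list (*s) [y, amult A y y, amult A (amult A y y) y]" for y
    proof -
      obtain a b c where y: "y = vec3 a b c" by (rule vec3_cases)
      show ?thesis
        unfolding dependent_list_3
        by (rule exI[of _ "p a b c"], rule exI[of _ "q a b c"], rule exI[of _ 1])
          (use pq[of a b c] in \<open>simp add: y Let_def\<close>)
    qed
    moreover have "\<not> dependent_list (*s) [x, amult A x x]"
      unfolding dependent_list_2 using x by blast
    ultimately show ?thesis
      unfolding waved_def curled_def by blast
  qed
  note s = amult_simps Let_def algebra_simps
  consider "A = W1" | "A = W2" | k where "A = W3 k" | k where "A = W3m k" | "A = W4" | "A = W5"
    | "A = W6" | "A = W7" | "A = W8" | "A = W9" | "A = W10" using assms by blast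
  then show ?thesis
  proof cases
    case 1 then show ?thesis
      by (simp, intro *[of "vec3 0 0 1" _ "\<lambda>a b c. 0" "\<lambda>a b c. 0"]) (auto simp: s)
  next
    case 2 then show ?thesis
      by (simp, intro *[of "vec3 0 1 1" _ "\<lambda>a b c. 0" "\<lambda>a b c. 0"]) (auto simp: s)
  next
    case 3 then show ?thesis
      by (simp, intro *[of "vec3 0 1 0" _ "\<lambda>a b c. 0" "\<lambda>a b c. 0"]) (auto simp: s)
  next
    case 4 then show ?thesis
      by (simp, intro *[of "vec3 0 1 0" _ "\<lambda>a b c. 0" "\<lambda>a b c. 0"]) (auto simp: s)
  next
    case 5 then show ?thesis
      by (simp, intro *[of "vec3 1 1 0" _ "\<lambda>a b c. 0" "\<lambda>a b c. - a"]) (auto simp: s)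
  next
    case 6 then show ?thesis
      by (simp, intro *[of "vec3 1 0 1" _ "\<lambda>a b c. 0" "\<lambda>a b c. - c"]) (auto simp: s)
  next
    case 7 then show ?thesis
      by (simp, intro *[of "vec3 1 0 1" _ "\<lambda>a b c. 0" "\<lambda>a b c. - c"]) (auto simp: s)
  next
    case 8 then show ?thesis
      by (simp, intro *[of "vec3 1 1 0" _ "\<lambda>a b c. a * c" "\<lambda>a b c. - (a + c)"]) (auto simp: s)
  next
    case 9 then show ?thesis
      by (simp, intro *[of "vec3 1 1 0" _ "\<lambda>a b c. a * c" "\<lambda>a b c. - (a + c)"]) (auto simp: s)
  next
    case 10 then show ?thesis
      by (simp, intro *[of "vec3 1 1 0" _ "\<lambda>a b c. b * b" "\<lambda>a b c. - 2 * b"]) (auto simp: s add_eq_0_iff)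
  next
    case 11 then show ?thesis
      by (simp, intro *[of "vec3 1 1 0" _ "\<lambda>a b c. b * b" "\<lambda>a b c. - 2 * b"]) (auto simp: s add_eq_0_iff)
  qed
qed

section \<open>Isomorphism invariants\<close>

lemma algebra_isomorphic_sym:
  assumes "algebra_isomorphic smul mul smul' mul'"
  shows "algebra_isomorphic smul' mul' smul mul"
proof -
  obtain f where f: "Vector_Spaces.linear smul smul' f" "bij f" "\<And>x y. f (mul x y) = mul' (f x) (f y)"
    using assms unfolding algebra_isomorphic_def by blast
  let ?g = "inv f"
  have fg: "f (?g y) = y" "?g (f x) = x" for x y
    using f(2) by (simp_all add: bij_is_surj surj_f_inv_f bij_is_inj)
  have "Vector_Spaces.linear smul' smul ?g"
    using f(1) unfolding Vector_Spaces.linear_iff by (metis fg)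
  moreover have "bij ?g"
    using f(2) by (rule bij_imp_bij_inv)
  moreover have "?g (mul' x y) = mul (?g x) (?g y)" for x y
    by (metis f(3) fg)
  ultimately show ?thesis
    unfolding algebra_isomorphic_def by blast
qed

lemma algebra_isomorphic_trans:
  assumes "algebra_isomorphic s1 m1 s2 m2" "algebra_isomorphic s2 m2 s3 m3"
  shows "algebra_isomorphic s1 m1 s3 m3"
proof -
  obtain f g where "Vector_Spaces.linear s1 s2 f" "bij f" "\<And>x y. f (m1 x y) = m2 (f x) (f y)"
    "Vector_Spaces.linear s2 s3 g" "bij g" "\<And>x y. g (m2 x y) = m3 (g x) (g y)"
    using assms unfolding algebra_isomorphic_def by blast
  then have "Vector_Spaces.linear s1 s3 (g \<circ> f)" "bij (g \<circ> f)" "\<And>x y. (g \<circ> f) (m1 x y) = m3 ((g \<circ> f) x) ((g \<circ> f) y)"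
    by (auto simp: Vector_Spaces.linear_iff intro: bij_comp)
  then show ?thesis
    unfolding algebra_isomorphic_def by blast
qed

text \<open>The following properties mention only the product, zero and negation, and so are invariant under
  isomorphism. Each separates a few tables of the same kind.\<close>
definition commutative :: "('a \<Rightarrow> 'a \<Rightarrow> 'a) \<Rightarrow> bool" where
  "commutative mul \<longleftrightarrow> (\<forall>x y. mul x y = mul y x)"

definition trivial_product :: "('a::zero \<Rightarrow> 'a \<Rightarrow> 'a) \<Rightarrow> bool" where
  "trivial_product mul \<longleftrightarrow> (\<forall>x y. mul x y = 0)"

definition squares_vanish :: "('a::zero \<Rightarrow> 'a \<Rightarrow> 'a) \<Rightarrow> bool" where
  "squares_vanish mul \<longleftrightarrow> (\<forall>x. mul x x = 0)"

definition has_square_zero :: "('a::zero \<Rightarrow> 'a \<Rightarrow> 'a) \<Rightarrow> bool" where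
  "has_square_zero mul \<longleftrightarrow> (\<exists>x. x \<noteq> 0 \<and> mul x x = 0)"

definition has_nonannihilating_square_zero :: "('a::zero \<Rightarrow> 'a \<Rightarrow> 'a) \<Rightarrow> bool" where
  "has_nonannihilating_square_zero mul \<longleftrightarrow> (\<exists>x y. mul x x = 0 \<and> mul x y \<noteq> 0)"

definition has_nilpotent_of_index_3 :: "('a::zero \<Rightarrow> 'a \<Rightarrow> 'a) \<Rightarrow> bool" where
  "has_nilpotent_of_index_3 mul \<longleftrightarrow> (\<exists>x. mul x x \<noteq> 0 \<and> mul (mul x x) x = 0)"

definition has_idempotent :: "('a::zero \<Rightarrow> 'a \<Rightarrow> 'a) \<Rightarrow> bool" where
  "has_idempotent mul \<longleftrightarrow> (\<exists>x. x \<noteq> 0 \<and> mul x x = x)"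

definition has_annihilated_idempotent :: "('a::zero \<Rightarrow> 'a \<Rightarrow> 'a) \<Rightarrow> bool" where
  "has_annihilated_idempotent mul \<longleftrightarrow>
     (\<exists>x y. x \<noteq> 0 \<and> mul x x = x \<and> y \<noteq> 0 \<and> mul x y = 0 \<and> mul y x = 0)"

definition has_left_peirce_component :: "('a::zero \<Rightarrow> 'a \<Rightarrow> 'a) \<Rightarrow> bool" where
  "has_left_peirce_component mul \<longleftrightarrow>
     (\<exists>x y. mul x x = x \<and> y \<noteq> 0 \<and> mul x y = y \<and> mul y x = 0)"

definition has_left_annihilator :: "('a::zero \<Rightarrow> 'a \<Rightarrow> 'a) \<Rightarrow> bool" where
  "has_left_annihilator mul \<longleftrightarrow> (\<exists>x. x \<noteq> 0 \<and> (\<forall>y. mul x y = 0))"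

definition has_right_annihilator :: "('a::zero \<Rightarrow> 'a \<Rightarrow> 'a) \<Rightarrow> bool" where
  "has_right_annihilator mul \<longleftrightarrow> (\<exists>x. x \<noteq> 0 \<and> (\<forall>y. mul y x = 0))"

definition has_one_sided_annihilator :: "('a::zero \<Rightarrow> 'a \<Rightarrow> 'a) \<Rightarrow> bool" where
  "has_one_sided_annihilator mul \<longleftrightarrow> (\<exists>x. (\<forall>y. mul x y = 0) \<and> (\<exists>y. mul y x \<noteq> 0))"

definition has_orthogonal_pair :: "('a::zero \<Rightarrow> 'a \<Rightarrow> 'a) \<Rightarrow> bool" where
  "has_orthogonal_pair mul \<longleftrightarrow> (\<exists>x y. mul x x \<noteq> 0 \<and> mul y y \<noteq> 0 \<and> mul x y = 0)"

text \<open>Such an element generates a subalgebra on which \<open>x\<^sup>2\<close> acts as \<open>- 1\<close>. Over the reals it exists in the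
  minus forms of \<open>U\<^sub>2\<close> and \<open>S\<^sub>3\<close> and nowhere in \<open>U\<^sub>2\<close> and \<open>S\<^sub>3\<close>.\<close>
definition has_imaginary_element :: "('a::ab_group_add \<Rightarrow> 'a \<Rightarrow> 'a) \<Rightarrow> bool" where
  "has_imaginary_element mul \<longleftrightarrow> (\<exists>x. x \<noteq> 0 \<and> mul (mul x x) x = - x)"

lemmas invariant_defs = commutative_def trivial_product_def squares_vanish_def has_square_zero_def
  has_nonannihilating_square_zero_def has_nilpotent_of_index_3_def has_idempotent_def
  has_annihilated_idempotent_def has_left_peirce_component_def has_left_annihilator_def
  has_right_annihilator_def has_one_sided_annihilator_def has_orthogonal_pair_def
  has_imaginary_element_def unital_def

text \<open>The graph of an isomorphism is a bi-total and bi-unique relation that respects the product,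
  zero and negation, so parametricity applies to each of the properties.\<close>
lemma isomorphic_invariants:
  assumes "algebra_isomorphic smul mul smul' mul'"
  shows "unital mul \<longleftrightarrow> unital mul'"
    and "commutative mul \<longleftrightarrow> commutative mul'"
    and "trivial_product mul \<longleftrightarrow> trivial_product mul'"
    and "squares_vanish mul \<longleftrightarrow> squares_vanish mul'"
    and "has_square_zero mul \<longleftrightarrow> has_square_zero mul'"
    and "has_nonannihilating_square_zero mul \<longleftrightarrow> has_nonannihilating_square_zero mul'"
    and "has_nilpotent_of_index_3 mul \<longleftrightarrow> has_nilpotent_of_index_3 mul'"
    and "has_idempotent mul \<longleftrightarrow> has_idempotent mul'"
    and "has_annihilated_idempotent mul \<longleftrightarrow> has_annihilated_idempotent mul'"
    and "has_left_peirce_component mul \<longleftrightarrow> has_left_peirce_component mul'"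
    and "has_left_annihilator mul \<longleftrightarrow> has_left_annihilator mul'"
    and "has_right_annihilator mul \<longleftrightarrow> has_right_annihilator mul'"
    and "has_one_sided_annihilator mul \<longleftrightarrow> has_one_sided_annihilator mul'"
    and "has_orthogonal_pair mul \<longleftrightarrow> has_orthogonal_pair mul'"
    and "has_imaginary_element mul \<longleftrightarrow> has_imaginary_element mul'"
proof -
  obtain f where f: "Vector_Spaces.linear smul smul' f" "bij f" "\<And>x y. f (mul x y) = mul' (f x) (f y)"
    using assms unfolding algebra_isomorphic_def by blast
  define R where "R = (\<lambda>x y. f x = y)"
  have [transfer_rule]: "bi_unique R" "bi_total R"
    using f(2) unfolding R_def bi_unique_def bi_total_def
    by (auto simp: bij_def inj_def surj_def) metis
  have add: "f (x + y) = f x + f y" for x y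
    using f(1) by (simp add: Vector_Spaces.linear_iff)
  then have zero: "f 0 = 0"
    by (metis add_cancel_right_right)
  then have [transfer_rule]: "R 0 0"
    by (simp add: R_def)
  have "f (- x) = - f x" for x
    using add[of x "- x"] zero by (simp add: minus_unique)
  then have [transfer_rule]: "rel_fun R R uminus uminus"
    by (simp add: R_def rel_fun_def)
  have [transfer_rule]: "rel_fun R (rel_fun R R) mul mul'"
    by (simp add: R_def rel_fun_def f(3))
  show "unital mul \<longleftrightarrow> unital mul'"
    "commutative mul \<longleftrightarrow> commutative mul'"
    "trivial_product mul \<longleftrightarrow> trivial_product mul'"
    "squares_vanish mul \<longleftrightarrow> squares_vanish mul'"
    "has_square_zero mul \<longleftrightarrow> has_square_zero mul'"
    "has_nonannihilating_square_zero mul \<longleftrightarrow> has_nonannihilating_square_zero mul'"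
    "has_nilpotent_of_index_3 mul \<longleftrightarrow> has_nilpotent_of_index_3 mul'"
    "has_idempotent mul \<longleftrightarrow> has_idempotent mul'"
    "has_annihilated_idempotent mul \<longleftrightarrow> has_annihilated_idempotent mul'"
    "has_left_peirce_component mul \<longleftrightarrow> has_left_peirce_component mul'"
    "has_left_annihilator mul \<longleftrightarrow> has_left_annihilator mul'"
    "has_right_annihilator mul \<longleftrightarrow> has_right_annihilator mul'"
    "has_one_sided_annihilator mul \<longleftrightarrow> has_one_sided_annihilator mul'"
    "has_orthogonal_pair mul \<longleftrightarrow> has_orthogonal_pair mul'"
    "has_imaginary_element mul \<longleftrightarrow> has_imaginary_element mul'"
    unfolding invariant_defs by transfer_prover+
qed

lemma isomorphic_kinds:
  assumes "algebra_isomorphic smul mul smul' mul'"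
  shows "straight smul mul \<longleftrightarrow> straight smul' mul'" and "waved smul mul \<longleftrightarrow> waved smul' mul'"
proof -
  obtain f where f: "Vector_Spaces.linear smul smul' f" "bij f" "\<And>x y. f (mul x y) = mul' (f x) (f y)"
    using assms unfolding algebra_isomorphic_def by blast
  have lin: "f (x + y) = f x + f y" "f (smul a x) = smul' a (f x)" for x y a
    using f(1) by (simp_all add: Vector_Spaces.linear_iff)
  then have "f 0 = 0"
    by (metis add_cancel_right_right)
  then have zero: "f x = 0 \<longleftrightarrow> x = 0" for x
    using f(2) by (metis bij_is_inj injD)
  have all: "(\<forall>y. P y) \<longleftrightarrow> (\<forall>x. P (f x))" for P
    using f(2) by (metis bij_is_surj surjD)
  have "smul' a (f x) + smul' b (f y) = 0 \<longleftrightarrow> smul a x + smul b y = 0"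
    "smul' a (f x) + smul' b (f y) + smul' c (f z) = 0 \<longleftrightarrow> smul a x + smul b y + smul c z = 0" for a b c x y z
    using zero[of "smul a x + smul b y"] zero[of "smul a x + smul b y + smul c z"]
    by (simp_all add: lin)
  then have "dependent_list smul' [f x, f y] \<longleftrightarrow> dependent_list smul [x, y]"
    "dependent_list smul' [f x, f y, f z] \<longleftrightarrow> dependent_list smul [x, y, z]" for x y z
    by (simp_all add: dependent_list_2 dependent_list_3)
  then have "curled smul' mul' \<longleftrightarrow> curled smul mul" "waved smul' mul' \<longleftrightarrow> waved smul mul"
    unfolding waved_def curled_def
    by (subst all, simp flip: f(3), subst (1 2) all, simp flip: f(3))
  then show "straight smul mul \<longleftrightarrow> straight smul' mul'" "waved smul mul \<longleftrightarrow> waved smul' mul'"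
    by (auto simp: straight_def)
qed

lemma spec_basis: "(\<forall>y. P y) \<Longrightarrow> P (vec3 1 0 0) \<and> P (vec3 0 1 0) \<and> P (vec3 0 0 1)"
  by blast

context
begin

private lemmas eval = amult_simps all_vec3 ex_vec3

lemma commutative_amult:
  "commutative (amult (U0 :: 'k::field_char_0 alg_name))" "\<not> commutative (amult (U1 :: 'k alg_name))"
  "commutative (amult (U2 :: 'k alg_name))" "commutative (amult (U3 :: 'k alg_name))"
  "commutative (amult (U4 :: 'k alg_name))" "commutative (amult (U2m :: 'k alg_name))"
  "commutative (amult (W4 :: 'k alg_name))"
  "\<not> commutative (amult (W5 :: 'k alg_name))" "\<not> commutative (amult (W6 :: 'k alg_name))"
  unfolding commutative_def
  by (simp_all add: eval algebra_simps) (metis mult_1 mult_zero_right zero_neq_one mult_1_right mult_zero_left add_0 diff_0 neg_equal_0_iff_equal)+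

lemma trivial_product_amult:
  "trivial_product (amult (C0 :: 'k::field_char_0 alg_name))" "\<not> trivial_product (amult (C1 :: 'k alg_name))"
proof -
  show "trivial_product (amult (C0 :: 'k alg_name))"
    by (simp add: trivial_product_def eval)
  have "amult C1 (vec3 0 1 0) (vec3 0 0 (1::'k)) \<noteq> 0"
    by (simp add: amult_simps)
  then show "\<not> trivial_product (amult (C1 :: 'k alg_name))"
    unfolding trivial_product_def by blast
qed

lemma squares_vanish_amult:
  fixes A :: "'k::field_char_0 alg_name"
  shows "A \<in> {C0, C1} \<Longrightarrow> squares_vanish (amult A)" "A \<in> {C2, C3, C4} \<Longrightarrow> \<not> squares_vanish (amult A)"
proof -
  show "A \<in> {C0, C1} \<Longrightarrow> squares_vanish (amult A)"
    by (auto simp: squares_vanish_def eval)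
  have "A \<in> {C2, C3, C4} \<Longrightarrow> amult A (vec3 0 1 1) (vec3 0 1 1) \<noteq> 0"
    by (auto simp: amult_simps)
  then show "A \<in> {C2, C3, C4} \<Longrightarrow> \<not> squares_vanish (amult A)"
    unfolding squares_vanish_def by blast
qed

lemma has_square_zero_amult:
  fixes A :: "'k::field_char_0 alg_name"
  shows "A \<in> {U0, U3, U4} \<Longrightarrow> has_square_zero (amult A)" "A \<in> {U2, U2m} \<Longrightarrow> \<not> has_square_zero (amult A)"
proof -
  show "A \<in> {U0, U3, U4} \<Longrightarrow> has_square_zero (amult A)"
    unfolding has_square_zero_def by (rule exI[of _ "vec3 0 0 1"]) (auto simp: amult_simps)
  show "A \<in> {U2, U2m} \<Longrightarrow> \<not> has_square_zero (amult A)"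
    by (auto simp: has_square_zero_def eval mult.commute simp flip: mult_2)
qed

lemma has_nonannihilating_square_zero_amult:
  fixes A :: "'k::field_char_0 alg_name"
  shows "has_nonannihilating_square_zero (amult (S4 :: 'k alg_name))"
    "A \<in> {S2, S3, S3m} \<Longrightarrow> \<not> has_nonannihilating_square_zero (amult A)"
proof -
  show "has_nonannihilating_square_zero (amult (S4 :: 'k alg_name))"
    unfolding has_nonannihilating_square_zero_def
    by (rule exI[of _ "vec3 0 1 0"], rule exI[of _ "vec3 1 0 0"]) (simp add: amult_simps)
  show "A \<in> {S2, S3, S3m} \<Longrightarrow> \<not> has_nonannihilating_square_zero (amult A)"
    by (auto simp: has_nonannihilating_square_zero_def eval mult.commute simp flip: mult_2)
qed

text \<open>In \<open>S\<^sub>3\<close> the plane of \<open>e, f\<close> has the two characters \<open>a + b\<close> and \<open>a - b\<close>, in its minus form the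
  multiplicative norm \<open>a\<^sup>2 + b\<^sup>2\<close>; these vanish at \<open>x\<close> when \<open>x\<^sup>3 = 0\<close>.\<close>
lemma has_nilpotent_of_index_3_amult:
  fixes A :: "'k::field_char_0 alg_name"
  shows "A \<in> {U4, S2} \<Longrightarrow> has_nilpotent_of_index_3 (amult A)"
    "A \<in> {U0, U3, S3, S3m} \<Longrightarrow> \<not> has_nilpotent_of_index_3 (amult A)"
proof -
  show "A \<in> {U4, S2} \<Longrightarrow> has_nilpotent_of_index_3 (amult A)"
    unfolding has_nilpotent_of_index_3_def by (rule exI[of _ "vec3 0 1 0"]) (auto simp: amult_simps)
  have S3: "a = 0 \<and> b = 0" if "(a * a + b * b) * a + (a * b + b * a) * b = 0" "(a * a + b * b) * b + (a * b + b * a) * a = 0"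
    for a b :: 'k
  proof -
    have "(a + b) ^ 3 = 0" "(a - b) ^ 3 = 0"
      using that by algebra+
    then have "a + b = 0" "a - b = 0" by simp_all
    then have "2 * a = 0" by algebra
    then show ?thesis using \<open>a - b = 0\<close> by simp
  qed
  have S3m: "a = 0 \<and> b = 0" if "(a * a - b * b) * a - (a * b + b * a) * b = 0" "(a * a - b * b) * b + (a * b + b * a) * a = 0"
    for a b :: 'k
  proof -
    have "(a * a + b * b) ^ 3 = 0"
      using that by algebra
    then have n: "a * a + b * b = 0" by simp
    then have "4 * (a * a * a) = 0" "4 * (b * b * b) = 0"
      using that by algebra+
    then show ?thesis by simp
  qed
  have "amult A x x = 0" if A: "A \<in> {U0, U3, S3, S3m}" and x: "amult A (amult A x x) x = 0" for x
  proof -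
    obtain a b c where abc: "x = vec3 a b c" by (rule vec3_cases)
    consider "A = U0 \<or> A = U3" | "A = S3" | "A = S3m" using A by blast
    then show ?thesis
    proof cases
      case 1
      with x show ?thesis by (auto simp: abc amult_simps)
    next
      case 2
      with x have "a = 0 \<and> b = 0"
        by (intro S3) (simp_all only: abc amult_simps vec3_arith)
      with 2 show ?thesis by (simp add: abc amult_simps)
    next
      case 3
      with x have "a = 0 \<and> b = 0"
        by (intro S3m) (simp_all only: abc amult_simps vec3_arith)
      with 3 show ?thesis by (simp add: abc amult_simps)
    qed
  qed
  then show "A \<in> {U0, U3, S3, S3m} \<Longrightarrow> \<not> has_nilpotent_of_index_3 (amult A)"
    unfolding has_nilpotent_of_index_3_def by blast
qed

lemma has_idempotent_amult:
  fixes A :: "'k::field_char_0 alg_name"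
  shows "A \<in> {S2, S3, S4, S3m, W4, W5, W6, W7, W8, W9, W10} \<Longrightarrow> has_idempotent (amult A)"
    "A \<in> {S1, W1, W2} \<union> range W3 \<union> range W3m \<Longrightarrow> \<not> has_idempotent (amult A)"
proof -
  have "A \<in> {S2, S3, S4, S3m, W4, W7, W8} \<Longrightarrow> amult A (vec3 1 0 0) (vec3 1 0 0) = vec3 1 0 0"
    "A \<in> {W5, W6} \<Longrightarrow> amult A (vec3 0 0 1) (vec3 0 0 1) = vec3 0 0 1"
    "A \<in> {W9, W10} \<Longrightarrow> amult A (vec3 0 1 0) (vec3 0 1 0) = vec3 0 1 0"
    by (auto simp: amult_simps)
  moreover have "vec3 1 0 (0::'k) \<noteq> 0" "vec3 0 1 (0::'k) \<noteq> 0" "vec3 0 0 (1::'k) \<noteq> 0"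
    by simp_all
  ultimately show "A \<in> {S2, S3, S4, S3m, W4, W5, W6, W7, W8, W9, W10} \<Longrightarrow> has_idempotent (amult A)"
    unfolding has_idempotent_def by blast
  show "A \<in> {S1, W1, W2} \<union> range W3 \<union> range W3m \<Longrightarrow> \<not> has_idempotent (amult A)"
    by (auto simp: has_idempotent_def eval)
qed

lemma has_annihilated_idempotent_amult:
  fixes A :: "'k::field_char_0 alg_name"
  shows "A \<in> {U3, W7, W8} \<Longrightarrow> has_annihilated_idempotent (amult A)"
    "A \<in> {U0, W9, W10} \<Longrightarrow> \<not> has_annihilated_idempotent (amult A)"
proof -
  show "A \<in> {U3, W7, W8} \<Longrightarrow> has_annihilated_idempotent (amult A)"
    unfolding has_annihilated_idempotent_def
    by (rule exI[of _ "vec3 1 0 0"], rule exI[of _ "vec3 0 0 1"]) (auto simp: amult_simps)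
  show "A \<in> {U0, W9, W10} \<Longrightarrow> \<not> has_annihilated_idempotent (amult A)"
    by (auto simp: has_annihilated_idempotent_def eval)
qed

lemma has_left_peirce_component_amult:
  "has_left_peirce_component (amult (W5 :: 'k::field_char_0 alg_name))"
  "\<not> has_left_peirce_component (amult (W6 :: 'k alg_name))"
proof -
  show "has_left_peirce_component (amult (W5 :: 'k alg_name))"
    unfolding has_left_peirce_component_def
    by (rule exI[of _ "vec3 0 0 1"], rule exI[of _ "vec3 0 1 0"]) (simp add: amult_simps)
  show "\<not> has_left_peirce_component (amult (W6 :: 'k alg_name))"
    by (auto simp: has_left_peirce_component_def eval)
qed

lemma has_left_annihilator_amult:
  fixes A :: "'k::field_char_0 alg_name"
  shows "A \<in> {C2, C3, W4, W5, W6, W7, W10} \<Longrightarrow> has_left_annihilator (amult A)"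
    "A \<in> {C4, W8, W9} \<Longrightarrow> \<not> has_left_annihilator (amult A)"
proof -
  have "A \<in> {C2, C3, W5, W6} \<Longrightarrow> \<forall>y. amult A (vec3 1 0 0) y = 0"
    "A \<in> {W4, W7} \<Longrightarrow> \<forall>y. amult A (vec3 0 1 0) y = 0"
    "A = W10 \<Longrightarrow> \<forall>y. amult A (vec3 0 0 1) y = 0"
    by (auto simp: eval)
  moreover have "vec3 1 0 (0::'k) \<noteq> 0" "vec3 0 1 (0::'k) \<noteq> 0" "vec3 0 0 (1::'k) \<noteq> 0"
    by simp_all
  ultimately show "A \<in> {C2, C3, W4, W5, W6, W7, W10} \<Longrightarrow> has_left_annihilator (amult A)"
    unfolding has_left_annihilator_def by blast
  have "x = 0" if A: "A \<in> {C4, W8, W9}" and x: "\<forall>y. amult A x y = 0" for x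
  proof -
    obtain a b c where abc: "x = vec3 a b c" by (rule vec3_cases)
    show ?thesis
      using A spec_basis[OF x] unfolding abc by (auto simp: amult_simps)
  qed
  then show "A \<in> {C4, W8, W9} \<Longrightarrow> \<not> has_left_annihilator (amult A)"
    unfolding has_left_annihilator_def by blast
qed

lemma has_right_annihilator_amult:
  fixes A :: "'k::field_char_0 alg_name"
  shows "A \<in> {C2, C4, W4, W5, W6, W8, W9} \<Longrightarrow> has_right_annihilator (amult A)"
    "A \<in> {C3, W7, W10} \<Longrightarrow> \<not> has_right_annihilator (amult A)"
proof -
  have "A \<in> {C4, W5, W6} \<Longrightarrow> \<forall>y. amult A y (vec3 1 0 0) = 0"
    "A \<in> {W4, W8} \<Longrightarrow> \<forall>y. amult A y (vec3 0 1 0) = 0"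
    "A \<in> {C2, W9} \<Longrightarrow> \<forall>y. amult A y (vec3 0 0 1) = 0"
    by (auto simp: eval)
  moreover have "vec3 1 0 (0::'k) \<noteq> 0" "vec3 0 1 (0::'k) \<noteq> 0" "vec3 0 0 (1::'k) \<noteq> 0"
    by simp_all
  ultimately show "A \<in> {C2, C4, W4, W5, W6, W8, W9} \<Longrightarrow> has_right_annihilator (amult A)"
    unfolding has_right_annihilator_def by blast
  have "x = 0" if A: "A \<in> {C3, W7, W10}" and x: "\<forall>y. amult A y x = 0" for x
  proof -
    obtain a b c where abc: "x = vec3 a b c" by (rule vec3_cases)
    show ?thesis
      using A spec_basis[OF x] unfolding abc by (auto simp: amult_simps)
  qed
  then show "A \<in> {C3, W7, W10} \<Longrightarrow> \<not> has_right_annihilator (amult A)"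
    unfolding has_right_annihilator_def by blast
qed

lemma has_one_sided_annihilator_amult:
  fixes A :: "'k::field_char_0 alg_name"
  shows "has_one_sided_annihilator (amult (W2 :: 'k alg_name))"
    "A \<in> {W1} \<union> range W3 \<union> range W3m \<Longrightarrow> \<not> has_one_sided_annihilator (amult A)"
proof -
  have "\<forall>y. amult W2 (vec3 0 1 (0::'k)) y = 0" "amult W2 (vec3 0 0 1) (vec3 0 1 (0::'k)) \<noteq> 0"
    by (simp_all add: eval)
  then show "has_one_sided_annihilator (amult (W2 :: 'k alg_name))"
    unfolding has_one_sided_annihilator_def by blast
  have "amult A y x = 0" if A: "A \<in> {W1} \<union> range W3 \<union> range W3m" and x: "\<forall>y. amult A x y = 0" for x y
  proof -
    obtain a b c p q r where abc: "x = vec3 a b c" "y = vec3 p q r" by (metis vec3_cases)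
    show ?thesis
      using A spec_basis[OF x] unfolding abc by (auto simp: amult_simps)
  qed
  then show "A \<in> {W1} \<union> range W3 \<union> range W3m \<Longrightarrow> \<not> has_one_sided_annihilator (amult A)"
    unfolding has_one_sided_annihilator_def by blast
qed

lemma has_orthogonal_pair_amult:
  fixes A :: "'k::field_char_0 alg_name"
  shows "A \<in> range W3 \<union> range W3m \<Longrightarrow> has_orthogonal_pair (amult A)"
    "\<not> has_orthogonal_pair (amult (W1 :: 'k alg_name))"
proof -
  show "A \<in> range W3 \<union> range W3m \<Longrightarrow> has_orthogonal_pair (amult A)"
    unfolding has_orthogonal_pair_def
    by (rule exI[of _ "vec3 0 1 0"], rule exI[of _ "vec3 0 0 1"]) (auto simp: amult_simps)
  show "\<not> has_orthogonal_pair (amult (W1 :: 'k alg_name))"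
    by (auto simp: has_orthogonal_pair_def eval)
qed

lemma has_imaginary_element_amult:
  fixes A :: "real alg_name"
  shows "A \<in> {U2m, S3m} \<Longrightarrow> has_imaginary_element (amult A)"
    "A \<in> {U2, S3} \<Longrightarrow> \<not> has_imaginary_element (amult A)"
proof -
  have "amult U2m (amult U2m x x) x = - x" if "x = vec3 0 0 (1::real)" for x
    by (simp add: that amult_simps)
  moreover have "amult S3m (amult S3m x x) x = - x" if "x = vec3 0 1 (0::real)" for x
    by (simp add: that amult_simps)
  moreover have "vec3 0 1 (0::real) \<noteq> 0" "vec3 0 0 (1::real) \<noteq> 0"
    by simp_all
  ultimately show "A \<in> {U2m, S3m} \<Longrightarrow> has_imaginary_element (amult A)"
    unfolding has_imaginary_element_def by blast
  have cube: "a = 0" if "a * (a * a + 3 * (b * b) + 1) = 0" for a b :: real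
    using that by (smt (verit) mult_eq_0_iff zero_le_square)
  have U2: "a = 0" if "a * a * a = - a" for a :: real
    using that cube[of a 0] by (simp add: algebra_simps)
  have S3: "a = 0 \<and> b = 0" if "(a * a + b * b) * a + (a * b + b * a) * b = - a" "(a * a + b * b) * b + (a * b + b * a) * a = - b"
    for a b :: real
    using that cube[of a b] cube[of b a] by (simp add: algebra_simps)
  have "x = 0" if A: "A \<in> {U2, S3}" and x: "amult A (amult A x x) x = - x" for x
  proof -
    obtain a b c where abc: "x = vec3 a b c" by (rule vec3_cases)
    consider "A = U2" | "A = S3" using A by blast
    then show ?thesis
    proof cases
      case 1
      with x have "a = 0" "b = 0" "c = 0"
        by (intro U2; simp only: abc amult_simps vec3_arith)+
      then show ?thesis by (simp add: abc)
    next
      case 2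
      with x have "a = 0 \<and> b = 0"
        by (intro S3) (simp_all only: abc amult_simps vec3_arith)
      moreover have "c = 0"
        using 2 x by (simp add: abc amult_simps)
      ultimately show ?thesis by (simp add: abc)
    qed
  qed
  then show "A \<in> {U2, S3} \<Longrightarrow> \<not> has_imaginary_element (amult A)"
    unfolding has_imaginary_element_def by blast
qed

end

section \<open>Exactly one name for each algebra\<close>

text \<open>An isomorphism sends \<open>e = f\<^sup>2\<close> to a multiple \<open>m e\<close>. Modulo \<open>e\<close> it is a change of basis of the plane
  with determinant \<open>d\<close>, and the two equations compare the determinants and the skew parts of the
  bilinear forms with matrices \<open>[[1, 0], [k, q]]\<close> and \<open>[[1, 0], [l, t]]\<close>.\<close>
lemma W3_form_invariants:
  fixes A :: "'k::field_char_0 alg_name"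
  assumes "algebra_isomorphic (*s) (amult A) (*s) (amult B)"
    and A: "(A = W3 k \<and> q = 1) \<or> (A = W3m k \<and> q = - 1)"
    and B: "(B = W3 l \<and> t = 1) \<or> (B = W3m l \<and> t = - 1)"
  obtains d m where "m \<noteq> 0" "t * (d * d) = q * (m * m)" "l * d = k * m"
proof -
  obtain f where f: "Vector_Spaces.linear (*s) (*s) f" "bij f" "\<And>x y. f (amult A x y) = amult B (f x) (f y)"
    using assms(1) unfolding algebra_isomorphic_def by blast
  have scale: "f (a *s x) = a *s f x" for a x
    using f(1) by (simp add: Vector_Spaces.linear_iff)
  have zero: "f 0 = 0"
    using scale[of 0 0] by simp
  let ?e = "vec3 1 0 (0::'k)" and ?f = "vec3 0 1 (0::'k)" and ?g = "vec3 0 0 (1::'k)"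
  have "f ?e \<noteq> 0"
    using f(2) zero by (metis bij_is_inj injD vec3_arith(6) zero_neq_one)
  have multA: "amult A ?f ?f = ?e" "amult A ?f ?g = 0" "amult A ?g ?f = k *s ?e" "amult A ?g ?g = q *s ?e"
    using A by (auto simp: amult_simps)
  obtain a b c p r s m m2 m3 where fs: "f ?f = vec3 p a c" "f ?g = vec3 r b s" "f ?e = vec3 m m2 m3"
    by (metis vec3_cases)
  have multB: "amult B (vec3 x1 x2 x3) (vec3 y1 y2 y3) = vec3 (x2 * y2 + l * (x3 * y2) + t * (x3 * y3)) 0 0"
    for x1 x2 x3 y1 y2 y3
    using B by (auto simp: amult_simps)
  have eqs: "amult B (f ?f) (f ?f) = f ?e" "amult B (f ?f) (f ?g) = 0" "amult B (f ?g) (f ?f) = k *s f ?e"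
    "amult B (f ?g) (f ?g) = q *s f ?e"
    using f(3)[of ?f ?f] f(3)[of ?f ?g] f(3)[of ?g ?f] f(3)[of ?g ?g] by (simp_all only: multA scale zero)
  then have m: "m2 = 0" "m3 = 0"
    and B: "a * a + l * (c * a) + t * (c * c) = m" "a * b + l * (c * b) + t * (c * s) = 0"
      "b * a + l * (s * a) + t * (s * c) = k * m" "b * b + l * (s * b) + t * (s * s) = q * m"
    unfolding fs multB by auto
  let ?d = "a * s - b * c"
  have "m \<noteq> 0"
    using \<open>f ?e \<noteq> 0\<close> m by (auto simp: fs)
  moreover have "t * (?d * ?d) = q * (m * m)"
  proof -
    have "t * (?d * ?d) = (a * a + l * (c * a) + t * (c * c)) * (b * b + l * (s * b) + t * (s * s))
        - (a * b + l * (c * b) + t * (c * s)) * (b * a + l * (s * a) + t * (s * c))"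
      by algebra
    also have "\<dots> = q * (m * m)"
      unfolding B by simp
    finally show ?thesis .
  qed
  moreover have "l * ?d = k * m"
  proof -
    have "l * ?d = (b * a + l * (s * a) + t * (s * c)) - (a * b + l * (c * b) + t * (c * s))"
      by algebra
    then show ?thesis
      unfolding B by simp
  qed
  ultimately show thesis
    using that by blast
qed

text \<open>First the kind is compared, then the invariants that matter within that kind.\<close>
lemma isomorphic_amult:
  fixes A :: "'k::field_char_0 alg_name"
  assumes "algebra_isomorphic (*s) (amult A) (*s) (amult B)"
  shows "A = B \<or> {A, B} = {U2, U2m} \<or> {A, B} = {S3, S3m} \<or> {A, B} \<subseteq> range W3 \<union> range W3m"
proof -
  define U C S W :: "'k alg_name set"
    where kinds: "U = {U0, U1, U2, U3, U4, U2m}" "C = {C0, C1, C2, C3, C4}" "S = {S1, S2, S3, S4, S3m}"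
      "W = {W1, W2, W4, W5, W6, W7, W8, W9, W10} \<union> range W3 \<union> range W3m"
  note inv = isomorphic_invariants[OF assms] isomorphic_kinds[OF assms]
  have "X \<in> U \<or> X \<in> C \<or> X \<in> S \<or> X \<in> W" for X
    by (cases X) (simp_all add: kinds)
  moreover have "X \<in> U \<longleftrightarrow> unital (amult X)" for X
    unfolding kinds using unital_amult not_unital_amult by blast
  moreover have "X \<in> C \<Longrightarrow> \<not> straight (*s) (amult X) \<and> \<not> waved (*s) (amult X)"
    "X \<in> S \<Longrightarrow> straight (*s) (amult X) \<and> \<not> waved (*s) (amult X)"
    "X \<in> W \<Longrightarrow> \<not> straight (*s) (amult X) \<and> waved (*s) (amult X)" for X
    using straight_amult[of X, folded kinds] curled_amult[of X, folded kinds] waved_amult[of X, folded kinds]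
    unfolding straight_def waved_def by blast+
  ultimately consider "A \<in> U" "B \<in> U" | "A \<in> C" "B \<in> C" | "A \<in> S" "B \<in> S" | "A \<in> W" "B \<in> W"
    using inv(1,16,17) by metis
  then show ?thesis
  proof cases
    case 1
    then show ?thesis
      using inv(2,5,7,9)
      by (unfold kinds, elim insertE emptyE, simp_all add: commutative_amult has_square_zero_amult
          has_nilpotent_of_index_3_amult has_annihilated_idempotent_amult insert_commute)
  next
    case 2
    then show ?thesis
      using inv(3,4,11,12)
      by (unfold kinds, elim insertE emptyE, simp_all add: trivial_product_amult squares_vanish_amult
          has_left_annihilator_amult has_right_annihilator_amult)
  next
    case 3
    then show ?thesis
      using inv(6,7,8)
      by (unfold kinds, elim insertE emptyE, simp_all add: has_nonannihilating_square_zero_amult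
          has_nilpotent_of_index_3_amult has_idempotent_amult insert_commute)
  next
    case 4
    then show ?thesis
      using inv(2,8-14)
      by (unfold kinds, elim UnE insertE emptyE imageE, simp_all add: commutative_amult has_idempotent_amult
          has_annihilated_idempotent_amult has_left_peirce_component_amult has_left_annihilator_amult
          has_right_annihilator_amult has_one_sided_annihilator_amult has_orthogonal_pair_amult)
  qed
qed

lemma amult_isoI:
  fixes u v w :: "'k::field_char_0^3"
  assumes "\<And>a b c. a *s u + b *s v + c *s w = 0 \<Longrightarrow> a = 0 \<and> b = 0 \<and> c = 0"
    and "\<forall>i j. amult A (vec3 u v w $ i) (vec3 u v w $ j) =
      (table B $ i $ j $ 1) *s u + (table B $ i $ j $ 2) *s v + (table B $ i $ j $ 3) *s w"
  shows "algebra_isomorphic (*s) (amult A) (*s) (amult B)"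
proof -
  interpret algebra_dim3 "(*s)" "amult A"
    using algebra3_amult by (simp add: algebra_dim3_iff)
  have "indep3 u v w"
    using assms(1) by (intro indep3I)
  then show ?thesis
    using assms(2) by (rule isoI)
qed

lemma W3_minus:
  fixes k :: "'k::field_char_0"
  shows "algebra_isomorphic (*s) (amult (W3 k)) (*s) (amult (W3 (- k)))"
    and "algebra_isomorphic (*s) (amult (W3m k)) (*s) (amult (W3m (- k)))"
  by (rule amult_isoI[of "vec3 1 0 0" "vec3 0 1 0" "vec3 0 0 (- 1)"]; simp add: table_simps table_mult_vec3)+

text \<open>Multiplying a basis vector by \<open>\<i>\<close> absorbs the sign.\<close>
lemma complex_minus_forms:
  shows "algebra_isomorphic (*s) (amult U2m) (*s) (amult (U2 :: complex alg_name))"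
    and "algebra_isomorphic (*s) (amult S3m) (*s) (amult (S3 :: complex alg_name))"
    and "algebra_isomorphic (*s) (amult (W3m k)) (*s) (amult (W3 (\<i> * k)))"
proof -
  show "algebra_isomorphic (*s) (amult U2m) (*s) (amult (U2 :: complex alg_name))"
    by (rule amult_isoI[of "vec3 1 0 0" "vec3 0 (1 / 2) (- \<i> / 2)" "vec3 0 (1 / 2) (\<i> / 2)"])
      (auto simp: table_simps table_mult_vec3)
  show "algebra_isomorphic (*s) (amult S3m) (*s) (amult (S3 :: complex alg_name))"
    by (rule amult_isoI[of "vec3 1 0 0" "vec3 0 \<i> 0" "vec3 0 0 1"])
      (auto simp: table_simps table_mult_vec3)
  show "algebra_isomorphic (*s) (amult (W3m k)) (*s) (amult (W3 (\<i> * k)))"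
    by (rule amult_isoI[of "vec3 1 0 0" "vec3 0 1 0" "vec3 0 0 \<i>"])
      (auto simp: table_simps table_mult_vec3)
qed

lemma exists_name:
  fixes smul :: "'k::nearly_closed_field \<Rightarrow> 'a::ab_group_add \<Rightarrow> 'a"
  assumes "algebra3 smul mul"
  shows "\<exists>A. algebra_isomorphic smul mul (*s) (amult A)"
proof -
  interpret algebra_over_ncf smul mul
    using assms by (simp add: algebra_over_ncf_def algebra_dim3_iff)
  show ?thesis by (rule classified)
qed

lemmas names_complex_defs = names_complex_def U_complex_def C_complex_def S_complex_def W_complex_def
lemmas names_real_defs = names_real_def U_real_def C_real_def S_real_def W_real_def

lemma exists_name_complex:
  fixes smul :: "complex \<Rightarrow> 'a::ab_group_add \<Rightarrow> 'a"
  assumes "algebra3 smul mul"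
  shows "\<exists>A\<in>names_complex. algebra_isomorphic smul mul (*s) (amult A)"
proof -
  let ?iso = "\<lambda>A. algebra_isomorphic smul mul (*s) (amult A)"
  have W3: "\<exists>A\<in>names_complex. ?iso A" if "?iso (W3 k)" for k
  proof -
    have "k \<in> half_plane \<or> - k \<in> half_plane"
      by (auto simp: half_plane_def)
    then show ?thesis
      using that algebra_isomorphic_trans[OF that W3_minus(1)] unfolding names_complex_defs by blast
  qed
  obtain A where A: "?iso A"
    using exists_name[OF assms] ..
  consider "A \<in> names_complex" | "A = U2m" | "A = S3m" | k where "A = W3 k" | k where "A = W3m k"
    by (cases A) (auto simp: names_complex_defs)
  then show ?thesis
  proof cases
    case 2
    with A have "?iso U2"
      using algebra_isomorphic_trans complex_minus_forms(1) by blast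
    then show ?thesis by (auto simp: names_complex_defs)
  next
    case 3
    with A have "?iso S3"
      using algebra_isomorphic_trans complex_minus_forms(2) by blast
    then show ?thesis by (auto simp: names_complex_defs)
  next
    case 5
    with A have "?iso (W3 (\<i> * k))"
      using algebra_isomorphic_trans complex_minus_forms(3) by blast
    then show ?thesis by (rule W3)
  qed (use A W3 in blast)+
qed

lemma exists_name_real:
  fixes smul :: "real \<Rightarrow> 'a::ab_group_add \<Rightarrow> 'a"
  assumes "algebra3 smul mul"
  shows "\<exists>A\<in>names_real. algebra_isomorphic smul mul (*s) (amult A)"
proof -
  let ?iso = "\<lambda>A. algebra_isomorphic smul mul (*s) (amult A)"
  obtain A where A: "?iso A"
    using exists_name[OF assms] ..
  have "A \<in> names_real \<or> (\<exists>k<0. A = W3 k \<or> A = W3m k)"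
    by (cases A) (auto simp: names_real_defs image_iff)
  then consider "A \<in> names_real" | k where "k < 0" "A = W3 k" | k where "k < 0" "A = W3m k"
    by blast
  then show ?thesis
  proof cases
    case 2
    then have "?iso (W3 (- k))" "W3 (- k) \<in> names_real"
      using A algebra_isomorphic_trans W3_minus(1) by (blast, auto simp: names_real_defs)
    then show ?thesis by blast
  next
    case 3
    then have "?iso (W3m (- k))" "W3m (- k) \<in> names_real"
      using A algebra_isomorphic_trans W3_minus(2) by (blast, auto simp: names_real_defs)
    then show ?thesis by blast
  qed (use A in blast)
qed

lemma equal_up_to_sign:
  fixes k l d m :: "'k::field"
  assumes "d * d = m * m" "m \<noteq> 0" "l * d = k * m"
  shows "l = k \<or> l = - k"
proof -
  have "(l * d) * (l * d) = (k * m) * (k * m)"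
    using assms(3) by simp
  then have "(l * l) * (m * m) = (k * k) * (m * m)"
    by (simp add: assms(1) ac_simps flip: assms(1))
  then show ?thesis
    using assms(2) by (simp add: square_eq_iff)
qed

lemma unique_name_complex:
  assumes AB: "A \<in> names_complex" "B \<in> names_complex"
    and iso: "algebra_isomorphic (*s) (amult A) (*s) (amult B)"
  shows "A = B"
proof -
  have "A = B \<or> (\<exists>k l. A = W3 k \<and> B = W3 l \<and> k \<in> half_plane \<and> l \<in> half_plane)"
    using isomorphic_amult[OF iso] AB by (auto simp: names_complex_defs doubleton_eq_iff)
  then show ?thesis
  proof (elim disjE exE conjE)
    fix k l assume kl: "A = W3 k" "B = W3 l" "k \<in> half_plane" "l \<in> half_plane"
    obtain d m where dm: "m \<noteq> 0" "1 * (d * d) = 1 * (m * m)" "l * d = k * m"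
      using W3_form_invariants[OF iso, of k 1 l 1] kl by blast
    then have "d * d = m * m" by simp
    then have "l = k \<or> l = - k"
      using dm by (intro equal_up_to_sign)
    then show ?thesis
      using kl by (auto simp: half_plane_def complex_eq_iff)
  qed
qed

lemma unique_name_real:
  assumes AB: "A \<in> names_real" "B \<in> names_real"
    and iso: "algebra_isomorphic (*s) (amult A) (*s) (amult B)"
  shows "A = B"
proof -
  have "{A, B} \<noteq> {U2, U2m}" "{A, B} \<noteq> {S3, S3m}"
    using isomorphic_invariants(15)[OF iso] has_imaginary_element_amult
    by (auto simp: doubleton_eq_iff)
  then have "A = B \<or> (\<exists>k l q t. k \<ge> 0 \<and> l \<ge> 0 \<and> ((A = W3 k \<and> q = (1::real)) \<or> (A = W3m k \<and> q = - 1))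
      \<and> ((B = W3 l \<and> t = (1::real)) \<or> (B = W3m l \<and> t = - 1)))"
    using isomorphic_amult[OF iso] AB by (auto simp: names_real_defs)
  then show ?thesis
  proof (elim disjE[of "A = B"] exE conjE)
    fix k l q t :: real
    assume kl: "k \<ge> 0" "l \<ge> 0"
      and A: "(A = W3 k \<and> q = 1) \<or> (A = W3m k \<and> q = - 1)" and B: "(B = W3 l \<and> t = 1) \<or> (B = W3m l \<and> t = - 1)"
    obtain d m where dm: "m \<noteq> 0" "t * (d * d) = q * (m * m)" "l * d = k * m"
      using W3_form_invariants[OF iso A B] by blast
    have "m * m > 0"
      using dm(1) not_real_square_gt_zero by blast
    then have "- (d * d) \<noteq> m * m" "d * d \<noteq> - (m * m)"
      using zero_le_square[of d] by linarith+
    then have "t = q"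
      using dm(2) A B by auto
    then have "d * d = m * m"
      using dm(2) A by auto
    then have "l = k \<or> l = - k"
      using dm by (intro equal_up_to_sign)
    then have "l = k"
      using kl by auto
    then show ?thesis
      using A B \<open>t = q\<close> by auto
  qed
qed

lemma unique_nameI:
  assumes "\<exists>A\<in>N. algebra_isomorphic smul mul (*s) (amult A)"
    and "\<And>A B. A \<in> N \<Longrightarrow> B \<in> N \<Longrightarrow> algebra_isomorphic (*s) (amult A) (*s) (amult B) \<Longrightarrow> A = B"
  shows "\<exists>!A. A \<in> N \<and> algebra_isomorphic smul mul (*s) (amult A)"
  using assms algebra_isomorphic_sym algebra_isomorphic_trans by metis

theorem mainTheorem1:
  "((\<forall>(smul :: complex \<Rightarrow> 'a::ab_group_add \<Rightarrow> 'a) mul. algebra3 smul mul \<longrightarrow>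
        (\<exists>!A. A \<in> names_complex \<and> algebra_isomorphic smul mul (*s) (amult A)))
    \<and> (\<forall>A\<in>names_complex. algebra3 (*s) (amult A))
    \<and> pairwise (\<lambda>A B. \<not> algebra_isomorphic (*s) (amult A) (*s) (amult B)) names_complex
    \<and> (\<forall>A\<in>U_complex. unital (amult A))
    \<and> (\<forall>A\<in>C_complex. \<not> unital (amult A) \<and> curled (*s) (amult A))
    \<and> (\<forall>A\<in>S_complex. \<not> unital (amult A) \<and> straight (*s) (amult A))
    \<and> (\<forall>A\<in>W_complex. \<not> unital (amult A) \<and> waved (*s) (amult A)))
   \<and>
   ((\<forall>(smul :: real \<Rightarrow> 'b::ab_group_add \<Rightarrow> 'b) mul. algebra3 smul mul \<longrightarrow>
        (\<exists>!A. A \<in> names_real \<and> algebra_isomorphic smul mul (*s) (amult A)))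
    \<and> (\<forall>A\<in>names_real. algebra3 (*s) (amult A))
    \<and> pairwise (\<lambda>A B. \<not> algebra_isomorphic (*s) (amult A) (*s) (amult B)) names_real
    \<and> (\<forall>A\<in>U_real. unital (amult A))
    \<and> (\<forall>A\<in>C_real. \<not> unital (amult A) \<and> curled (*s) (amult A))
    \<and> (\<forall>A\<in>S_real. \<not> unital (amult A) \<and> straight (*s) (amult A))
    \<and> (\<forall>A\<in>W_real. \<not> unital (amult A) \<and> waved (*s) (amult A)))"
proof (intro conjI allI impI ballI)
  fix smul :: "complex \<Rightarrow> 'a \<Rightarrow> 'a" and mul
  assume "algebra3 smul mul"
  then show "\<exists>!A. A \<in> names_complex \<and> algebra_isomorphic smul mul (*s) (amult A)"
    by (intro unique_nameI exists_name_complex unique_name_complex)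
next
  fix smul :: "real \<Rightarrow> 'b \<Rightarrow> 'b" and mul
  assume "algebra3 smul mul"
  then show "\<exists>!A. A \<in> names_real \<and> algebra_isomorphic smul mul (*s) (amult A)"
    by (intro unique_nameI exists_name_real unique_name_real)
next
  show "pairwise (\<lambda>A B. \<not> algebra_isomorphic (*s) (amult A) (*s) (amult B)) names_complex"
    using unique_name_complex by (auto simp: pairwise_def)
  show "pairwise (\<lambda>A B. \<not> algebra_isomorphic (*s) (amult A) (*s) (amult B)) names_real"
    using unique_name_real by (auto simp: pairwise_def)
qed (auto simp: algebra3_amult U_complex_def C_complex_def S_complex_def W_complex_def
    U_real_def C_real_def S_real_def W_real_def
    intro!: unital_amult not_unital_amult curled_amult straight_amult waved_amult
    dest: not_unital_amult)

end
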